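(* Let $n=2$ and $d\geq 2$, and work in the polynomial ring $\mathbb C[u_{d0},u_{(d-1)1},\dots,u_{0d}]$ (coordinates on $S^d(\mathbb C^2)$). For $y,v\in\mathbb Z_{\geq0}^2$ with $y_1+y_2=v_1+v_2=d-1$, $y_2\geq1$, $v_1\geq1$, let $$f_{y,v}=u_{y+e_1}u_{v+e_1}-u_{y+2e_1-e_2}u_{v+e_2}+u_{y+e_2}u_{v+e_2}-u_{y+e_1}u_{v-e_1+2e_2},$$ and let $I$ be the ideal generated by all such $f_{y,v}$. Let $\prec$ be the term order given by the weights $\mathrm{weight}(u_{i(d-i)})=i$, $i=0,\dots,d$, with ties broken by the lexicographic order with $u_{d0}\succ u_{(d-1)1}\succ\dots\succ u_{0d}$. Then the polynomials $f_{y,v}$ form a Gröbner basis of $I$ with respect to $\prec$, the variety $\mathcal V(I)\subseteq S^d(\mathbb C^2)$ has dimension $3=\binom{2+1}{2}$, and $I$ is the prime ideal of the odeco variety in $S^d(\mathbb C^2)$.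
   Context: For $T\in S^d(\mathbb C^2)$ and $a=(a_1,a_2)\in\mathbb Z_{\geq0}^2$ with $a_1+a_2=d$, $u_{a}=u_{a_1a_2}=d!\,T_{1\dots1\,2\dots2}$ (index $1$ repeated $a_1$ times, index $2$ repeated $a_2$ times); $e_1,e_2$ are the standard basis vectors. A real tensor $T\in S^d(\mathbb R^2)$ is odeco if $T=\lambda_1v_1^{\otimes d}+\lambda_2v_2^{\otimes d}$ with $v_1,v_2$ an orthonormal basis of $\mathbb R^2$ and $\lambda_1,\lambda_2\in\mathbb R$; the odeco variety is the Zariski closure in $S^d(\mathbb C^2)$ of the set of odeco tensors. *)

theory Defs
  imports Complex_Main "HOL-Library.Poly_Mapping"
begin

(* Multivariate polynomials over the complex numbers in variables u_0, u_1, ...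
  (variable index i stands for the coordinate u_{i(d-i)} of S^d(C^2)).
  A monomial is a finitely supported exponent vector nat \<Rightarrow>\<^sub>0 nat. *)

type_synonym monom = "nat \<Rightarrow>\<^sub>0 nat"
type_synonym mpoly = "monom \<Rightarrow>\<^sub>0 complex"

definition Var :: "nat \<Rightarrow> mpoly" where
  "Var i = Poly_Mapping.single (Poly_Mapping.single i 1) 1"

definition eval_monom :: "monom \<Rightarrow> (nat \<Rightarrow> complex) \<Rightarrow> complex" where
  "eval_monom m x = (\<Prod>i\<in>Poly_Mapping.keys m. x i ^ Poly_Mapping.lookup m i)"

definition eval_mpoly :: "mpoly \<Rightarrow> (nat \<Rightarrow> complex) \<Rightarrow> complex" where
  "eval_mpoly p x = (\<Sum>m\<in>Poly_Mapping.keys p. Poly_Mapping.lookup p m * eval_monom m x)"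

definition polyring :: "nat \<Rightarrow> mpoly set" where
  "polyring d = {p. \<forall>m\<in>Poly_Mapping.keys p. \<forall>i\<in>Poly_Mapping.keys m. i \<le> d}"

definition is_ideal_in :: "mpoly set \<Rightarrow> mpoly set \<Rightarrow> bool" where
  "is_ideal_in R J \<longleftrightarrow> J \<subseteq> R \<and> 0 \<in> J \<and> (\<forall>a\<in>J. \<forall>b\<in>J. a + b \<in> J)
     \<and> (\<forall>r\<in>R. \<forall>a\<in>J. r * a \<in> J)"

definition ideal_gen :: "nat \<Rightarrow> mpoly set \<Rightarrow> mpoly set" where
  "ideal_gen d S = \<Inter>{J. is_ideal_in (polyring d) J \<and> S \<subseteq> J}"

definition prime_ideal :: "nat \<Rightarrow> mpoly set \<Rightarrow> bool" where
  "prime_ideal d J \<longleftrightarrow> is_ideal_in (polyring d) J \<and> J \<noteq> polyring d \<and>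
     (\<forall>f\<in>polyring d. \<forall>g\<in>polyring d. f * g \<in> J \<longrightarrow> f \<in> J \<or> g \<in> J)"

(* Coordinate u_a for a = (a1,a2) with a1 + a2 = d is the variable with index a1. *)
definition u :: "nat \<times> nat \<Rightarrow> mpoly" where
  "u a = Var (fst a)"

definition f_yv :: "nat \<times> nat \<Rightarrow> nat \<times> nat \<Rightarrow> mpoly" where
  "f_yv y v =
     u (fst y + 1, snd y) * u (fst v + 1, snd v)
   - u (fst y + 2, snd y - 1) * u (fst v, snd v + 1)
   + u (fst y, snd y + 1) * u (fst v, snd v + 1)
   - u (fst y + 1, snd y) * u (fst v - 1, snd v + 2)"

definition gens :: "nat \<Rightarrow> mpoly set" where
  "gens d = {f_yv y v | y v. fst y + snd y = d - 1 \<and> fst v + snd v = d - 1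
                              \<and> snd y \<ge> 1 \<and> fst v \<ge> 1}"

definition mweight :: "monom \<Rightarrow> nat" where
  "mweight m = (\<Sum>i\<in>Poly_Mapping.keys m. i * Poly_Mapping.lookup m i)"

definition lex_less :: "monom \<Rightarrow> monom \<Rightarrow> bool" where
  "lex_less m m' \<longleftrightarrow> (\<exists>j. Poly_Mapping.lookup m j < Poly_Mapping.lookup m' j \<and> (\<forall>k>j. Poly_Mapping.lookup m k = Poly_Mapping.lookup m' k))"

definition term_less :: "monom \<Rightarrow> monom \<Rightarrow> bool" where
  "term_less m m' \<longleftrightarrow> mweight m < mweight m' \<or> (mweight m = mweight m' \<and> lex_less m m')"

definition lead_monom :: "mpoly \<Rightarrow> monom" where
  "lead_monom p = (THE m. m \<in> Poly_Mapping.keys p \<and> (\<forall>m'\<in>Poly_Mapping.keys p. m' \<noteq> m \<longrightarrow> term_less m' m))"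

definition monom_dvd :: "monom \<Rightarrow> monom \<Rightarrow> bool" where
  "monom_dvd m m' \<longleftrightarrow> (\<forall>i. Poly_Mapping.lookup m i \<le> Poly_Mapping.lookup m' i)"

definition groebner_basis :: "mpoly set \<Rightarrow> mpoly set \<Rightarrow> bool" where
  "groebner_basis G J \<longleftrightarrow> G \<subseteq> J \<and>
     (\<forall>f\<in>J. f \<noteq> 0 \<longrightarrow> (\<exists>g\<in>G. g \<noteq> 0 \<and> monom_dvd (lead_monom g) (lead_monom f)))"

(* Affine space S^d(C^2) = C^{d+1}, as points x with x i = 0 for i > d. *)
definition aspace :: "nat \<Rightarrow> (nat \<Rightarrow> complex) set" where
  "aspace d = {x. \<forall>i>d. x i = 0}"

definition zero_set :: "nat \<Rightarrow> mpoly set \<Rightarrow> (nat \<Rightarrow> complex) set" where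
  "zero_set d S = {x\<in>aspace d. \<forall>f\<in>S. eval_mpoly f x = 0}"

definition vanishing_ideal :: "nat \<Rightarrow> (nat \<Rightarrow> complex) set \<Rightarrow> mpoly set" where
  "vanishing_ideal d Z = {f\<in>polyring d. \<forall>x\<in>Z. eval_mpoly f x = 0}"

definition zariski_closed :: "nat \<Rightarrow> (nat \<Rightarrow> complex) set \<Rightarrow> bool" where
  "zariski_closed d C \<longleftrightarrow> (\<exists>S\<subseteq>polyring d. C = zero_set d S)"

definition zariski_closure :: "nat \<Rightarrow> (nat \<Rightarrow> complex) set \<Rightarrow> (nat \<Rightarrow> complex) set" where
  "zariski_closure d Z = \<Inter>{C. zariski_closed d C \<and> Z \<subseteq> C}"

definition irreducible_closed :: "nat \<Rightarrow> (nat \<Rightarrow> complex) set \<Rightarrow> bool" where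
  "irreducible_closed d Z \<longleftrightarrow> zariski_closed d Z \<and> Z \<noteq> {} \<and>
     (\<forall>A B. zariski_closed d A \<and> zariski_closed d B \<and> Z = A \<union> B \<longrightarrow> Z = A \<or> Z = B)"

definition irr_chain :: "nat \<Rightarrow> (nat \<Rightarrow> complex) set \<Rightarrow> nat \<Rightarrow> bool" where
  "irr_chain d V n \<longleftrightarrow> (\<exists>Z :: nat \<Rightarrow> (nat \<Rightarrow> complex) set.
     (\<forall>k\<le>n. irreducible_closed d (Z k) \<and> Z k \<subseteq> V) \<and> (\<forall>k<n. Z k \<subset> Z (Suc k)))"

definition has_dim :: "nat \<Rightarrow> (nat \<Rightarrow> complex) set \<Rightarrow> nat \<Rightarrow> bool" where
  "has_dim d V n \<longleftrightarrow> irr_chain d V n \<and> \<not> irr_chain d V (Suc n)"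

(* Real odeco tensors T = l1 v1^d + l2 v2^d (v1, v2 orthonormal in R^2), in coordinates
  u_{i(d-i)} = d! T_{1..1 2..2} = d! (l1 p1^i q1^(d-i) + l2 p2^i q2^(d-i)), v_k = (p_k, q_k). *)
definition odeco_tensors :: "nat \<Rightarrow> (nat \<Rightarrow> complex) set" where
  "odeco_tensors d = {x. \<exists>(l1::real) l2 p1 q1 p2 q2.
      p1\<^sup>2 + q1\<^sup>2 = 1 \<and> p2\<^sup>2 + q2\<^sup>2 = 1 \<and> p1 * p2 + q1 * q2 = 0 \<and>
      x = (\<lambda>i. if i \<le> d then complex_of_real (fact d *
              (l1 * p1 ^ i * q1 ^ (d - i) + l2 * p2 ^ i * q2 ^ (d - i))) else 0)}"

definition odeco_variety :: "nat \<Rightarrow> (nat \<Rightarrow> complex) set" where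
  "odeco_variety d = zariski_closure d (odeco_tensors d)"

end

theory Submission
  imports Defs "HOL-Computational_Algebra.Polynomial" "HOL-Library.FuncSet"
begin

text \<open>The generators are the \<open>2 \<times> 2\<close> minors of the matrix with columns
  \<open>(u\<^sub>k, u\<^bsub>k+1\<^esub> - u\<^bsub>k-1\<^esub>)\<close>, \<open>1 \<le> k < d\<close>, which has rank one at odeco tensors. Their
  leading monomials are the \<open>u\<^sub>i u\<^sub>j\<close> with \<open>1 \<le> i\<close> and \<open>i + 2 \<le> j \<le> d\<close>, so modulo \<open>I\<close> every
  polynomial is a combination of the standard monomials \<open>u\<^sub>0\<^sup>k u\<^sub>i\<^sup>p u\<^bsub>i+1\<^esub>\<^sup>q\<close>. On the other hand,
  the real points of \<open>u\<^sub>i = a t\<^sup>i + b (-1)\<^sup>i t\<^bsup>d-i\<^esup>\<close> are odeco tensors, and this substitution sends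
  distinct standard monomials to polynomials in \<open>a, b, t\<close> with distinct leading monomials. Hence
  \<open>I\<close> is the kernel of a homomorphism to \<open>\<complex>[a, b, t]\<close>: it is prime, it is the vanishing ideal of
  the odeco tensors, and no leading monomial of an element of \<open>I\<close> is standard. A chain of \<open>n + 1\<close>
  irreducible closed sets yields \<open>n\<close> functions that are algebraically independent modulo \<open>I\<close>,
  and \<open>\<complex>[a, b, t]\<close> contains at most three algebraically independent elements.\<close>

section \<open>Monomials, substitution and evaluation\<close>

abbreviation lookup :: "('a \<Rightarrow>\<^sub>0 'b::zero) \<Rightarrow> 'a \<Rightarrow> 'b" where
  "lookup \<equiv> Poly_Mapping.lookup"

abbreviation keys :: "('a \<Rightarrow>\<^sub>0 'b::zero) \<Rightarrow> 'a set" where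
  "keys \<equiv> Poly_Mapping.keys"

abbreviation single :: "'a \<Rightarrow> 'b \<Rightarrow> 'a \<Rightarrow>\<^sub>0 'b::zero" where
  "single \<equiv> Poly_Mapping.single"

lemma sum_single_lookup: "(\<Sum>m\<in>keys p. single m (lookup p m)) = p"
  by (rule poly_mapping_eqI) (auto simp: lookup_sum lookup_single when_def in_keys_iff)

lemma lookup_const_mult: "lookup (single 0 c * p) m = c * lookup p m"
  for p :: "'a::monoid_add \<Rightarrow>\<^sub>0 'b::semiring_0"
  by (simp add: map.rep_eq when_def flip: mult_map_scale_conv_mult)

lemma Var_nonzero [simp]: "Var i \<noteq> 0"
  unfolding Var_def by (metis keys_single keys_zero insert_not_empty one_neq_zero)

lemma Var_power: "Var i ^ k = single (single i k) 1"
  by (induction k) (simp_all add: Var_def mult_single flip: single_add)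

definition monom_prod :: "(nat \<Rightarrow> 'a::comm_monoid_mult) \<Rightarrow> monom \<Rightarrow> 'a" where
  "monom_prod x m = (\<Prod>i\<in>keys m. x i ^ lookup m i)"

lemma monom_prod_superset:
  assumes "finite A" "keys m \<subseteq> A"
  shows "monom_prod x m = (\<Prod>i\<in>A. x i ^ lookup m i)"
  unfolding monom_prod_def using assms
  by (intro prod.mono_neutral_left) (auto simp: in_keys_iff)

lemma monom_prod_add: "monom_prod x (m + n) = monom_prod x m * monom_prod x n"
proof -
  let ?A = "keys m \<union> keys n"
  have "finite ?A" "keys (m + n) \<subseteq> ?A"
    using keys_add[of m n] by auto
  then show ?thesis
    by (simp add: monom_prod_superset[of ?A] lookup_add prod.distrib power_add)
qed

lemma monom_prod_zero [simp]: "monom_prod x 0 = 1"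
  by (simp add: monom_prod_def)

lemma monom_prod_single [simp]: "monom_prod x (single i k) = x i ^ k"
  by (cases "k = 0") (auto simp: monom_prod_def)

definition wdeg :: "(nat \<Rightarrow> nat) \<Rightarrow> monom \<Rightarrow> nat" where
  "wdeg w m = (\<Sum>i\<in>keys m. w i * lookup m i)"

lemma wdeg_superset:
  assumes "finite A" "keys m \<subseteq> A"
  shows "wdeg w m = (\<Sum>i\<in>A. w i * lookup m i)"
  unfolding wdeg_def using assms
  by (intro sum.mono_neutral_left) (auto simp: in_keys_iff)

lemma wdeg_add: "wdeg w (m + n) = wdeg w m + wdeg w n"
  unfolding wdeg_def by (rule setsum_keys_plus_distrib) (simp_all add: distrib_left)

lemma wdeg_single [simp]: "wdeg w (single i k) = w i * k"
  by (cases "k = 0") (auto simp: wdeg_def)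

lemma mweight_eq_wdeg: "mweight = wdeg (\<lambda>i. i)"
  by (simp add: fun_eq_iff mweight_def wdeg_def)

locale coeff_hom =
  fixes h :: "complex \<Rightarrow> 'a::comm_ring_1"
  assumes hom_add: "h (a + b) = h a + h b"
    and hom_mult: "h (a * b) = h a * h b"
    and hom_one: "h 1 = 1"
begin

definition subst :: "(nat \<Rightarrow> 'a) \<Rightarrow> mpoly \<Rightarrow> 'a" where
  "subst x p = (\<Sum>m\<in>keys p. h (lookup p m) * monom_prod x m)"

lemma hom_zero: "h 0 = 0"
  using hom_add[of 0 0] by simp

lemma subst_single [simp]: "subst x (single m c) = h c * monom_prod x m"
  by (cases "c = 0") (simp_all add: subst_def hom_zero)

lemma subst_zero [simp]: "subst x 0 = 0"
  by (simp add: subst_def)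

lemma subst_one [simp]: "subst x 1 = 1"
  by (simp add: subst_def hom_one)

lemma subst_Var [simp]: "subst x (Var i) = x i"
  by (simp add: Var_def hom_one)

lemma subst_add [simp]: "subst x (p + q) = subst x p + subst x q"
  unfolding subst_def
  by (rule setsum_keys_plus_distrib) (simp_all add: hom_zero hom_add distrib_right)

lemma subst_uminus [simp]: "subst x (- p) = - subst x p"
  using subst_add[of x p "- p"] by (simp add: eq_neg_iff_add_eq_0 add.commute)

lemma subst_diff [simp]: "subst x (p - q) = subst x p - subst x q"
  using subst_add[of x p "- q"] by simp

lemma subst_sum [simp]: "subst x (\<Sum>i\<in>A. p i) = (\<Sum>i\<in>A. subst x (p i))"
  by (induction A rule: infinite_finite_induct) auto

lemma subst_mult [simp]: "subst x (p * q) = subst x p * subst x q"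
proof -
  have "p * q = (\<Sum>m\<in>keys p. \<Sum>n\<in>keys q. single (m + n) (lookup p m * lookup q n))"
    by (subst (1 2) sum_single_lookup[symmetric]) (simp add: sum_product mult_single)
  then show ?thesis
    by (simp add: monom_prod_add hom_mult subst_def[of x p] subst_def[of x q] sum_product mult_ac)
qed

lemma subst_power [simp]: "subst x (p ^ n) = subst x p ^ n"
  by (induction n) auto

lemma hom_subst:
  assumes h': "coeff_hom h'"
    and add: "\<And>a b. e (a + b) = e a + e b"
    and mult: "\<And>a b. e (a * b) = e a * e b"
    and const: "\<And>c. e (h c) = h' c"
  shows "e (subst x p) = coeff_hom.subst h' (\<lambda>i. e (x i)) p"
proof -
  interpret h': coeff_hom h' by (rule h')
  have zero: "e 0 = 0" and one: "e 1 = 1"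
    using const[of 0] const[of 1] by (simp_all add: hom_zero hom_one h'.hom_zero h'.hom_one)
  have sum: "e (\<Sum>m\<in>A. f m) = (\<Sum>m\<in>A. e (f m))" for f :: "monom \<Rightarrow> 'a" and A
    by (induction A rule: infinite_finite_induct) (simp_all add: zero add)
  have power: "e (a ^ k) = e a ^ k" for a k
    by (induction k) (simp_all add: one mult)
  have prod: "e (\<Prod>i\<in>A. f i) = (\<Prod>i\<in>A. e (f i))" for f :: "nat \<Rightarrow> 'a" and A
    by (induction A rule: infinite_finite_induct) (simp_all add: one mult)
  show ?thesis
    by (simp add: subst_def h'.subst_def sum mult const monom_prod_def prod power)
qed

end

lemma coeff_hom_id: "coeff_hom (\<lambda>c. c)"
  by unfold_locales auto

lemma subst_id_eq_eval_mpoly: "coeff_hom.subst (\<lambda>c. c) x p = eval_mpoly p x"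
  by (simp add: coeff_hom.subst_def[OF coeff_hom_id] eval_mpoly_def eval_monom_def monom_prod_def)

interpretation eval_mpoly: coeff_hom "\<lambda>c. c"
  rewrites "coeff_hom.subst (\<lambda>c. c) x p = eval_mpoly p x"
  by (rule coeff_hom_id subst_id_eq_eval_mpoly)+

global_interpretation mpoly_compose: coeff_hom "single (0 :: monom)"
  defines mpoly_compose = mpoly_compose.subst
  by unfold_locales (simp_all add: single_add mult_single)

lemma (in coeff_hom) eval_subst:
  assumes "\<And>a b. e (a + b) = e a + e b" "\<And>a b. e (a * b) = e a * e b" "\<And>c. e (h c) = c"
  shows "e (subst x p) = eval_mpoly p (\<lambda>i. e (x i))"
  using hom_subst[OF coeff_hom_id assms] by (simp add: subst_id_eq_eval_mpoly)

lemma eval_mpoly_compose: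
  "eval_mpoly (mpoly_compose f p) x = eval_mpoly p (\<lambda>i. eval_mpoly (f i) x)"
  by (rule mpoly_compose.eval_subst) simp_all

lemma mpoly_compose_compose:
  "mpoly_compose g (mpoly_compose f p) = mpoly_compose (\<lambda>i. mpoly_compose g (f i)) p"
  by (rule mpoly_compose.hom_subst[OF mpoly_compose.coeff_hom_axioms, folded mpoly_compose_def])
    simp_all

section \<open>Polynomials in a given set of variables\<close>

definition polys_in :: "nat set \<Rightarrow> mpoly set" where
  "polys_in V = {p. \<forall>m\<in>keys p. keys m \<subseteq> V}"

lemma polyring_eq: "polyring d = polys_in {..d}"
  by (auto simp: polyring_def polys_in_def)

lemma polys_in_single: "keys m \<subseteq> V \<Longrightarrow> single m c \<in> polys_in V"
  by (simp add: polys_in_def)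

lemma polys_in_const: "single 0 c \<in> polys_in V"
  by (simp add: polys_in_single)

lemma polys_in_zero: "0 \<in> polys_in V"
  by (simp add: polys_in_def)

lemma polys_in_one: "1 \<in> polys_in V"
  by (simp add: polys_in_def)

lemma polys_in_Var: "i \<in> V \<Longrightarrow> Var i \<in> polys_in V"
  by (simp add: Var_def polys_in_single)

lemma polys_in_add: "p \<in> polys_in V \<Longrightarrow> q \<in> polys_in V \<Longrightarrow> p + q \<in> polys_in V"
  using keys_add[of p q] by (auto simp: polys_in_def)

lemma polys_in_uminus: "p \<in> polys_in V \<Longrightarrow> - p \<in> polys_in V"
  by (simp add: polys_in_def)

lemma polys_in_diff: "p \<in> polys_in V \<Longrightarrow> q \<in> polys_in V \<Longrightarrow> p - q \<in> polys_in V"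
  using keys_diff[of p q] by (auto simp: polys_in_def)

lemma polys_in_mult:
  assumes "p \<in> polys_in V" "q \<in> polys_in V"
  shows "p * q \<in> polys_in V"
  unfolding polys_in_def
proof (intro CollectI ballI)
  fix m assume "m \<in> keys (p * q)"
  then obtain a b where "m = a + b" "a \<in> keys p" "b \<in> keys q"
    using keys_mult[of p q] by blast
  then show "keys m \<subseteq> V"
    using assms keys_add[of a b] by (fastforce simp: polys_in_def)
qed

lemma polys_in_power: "p \<in> polys_in V \<Longrightarrow> p ^ n \<in> polys_in V"
  by (induction n) (auto intro: polys_in_one polys_in_mult)

lemma polys_in_sum: "(\<And>i. i \<in> A \<Longrightarrow> p i \<in> polys_in V) \<Longrightarrow> sum p A \<in> polys_in V"
  by (induction A rule: infinite_finite_induct) (auto intro: polys_in_zero polys_in_add)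

lemma polys_in_prod: "(\<And>i. i \<in> A \<Longrightarrow> p i \<in> polys_in V) \<Longrightarrow> prod p A \<in> polys_in V"
  by (induction A rule: infinite_finite_induct) (auto intro: polys_in_one polys_in_mult)

lemmas polys_in_intros = polys_in_const polys_in_zero polys_in_one polys_in_Var polys_in_add
  polys_in_uminus polys_in_diff polys_in_mult polys_in_power polys_in_sum polys_in_prod

lemma polys_in_empty: "p \<in> polys_in {} \<Longrightarrow> p = single 0 (lookup p 0)"
  by (rule poly_mapping_eqI) (auto simp: polys_in_def lookup_single when_def in_keys_iff)

lemma polys_in_finite_vars: "\<exists>V. finite V \<and> p \<in> polys_in V"
  by (rule exI[of _ "\<Union>m\<in>keys p. keys m"]) (auto simp: polys_in_def)

lemma polys_in_compose:
  assumes "p \<in> polys_in V" "\<And>i. i \<in> V \<Longrightarrow> f i \<in> polys_in W"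
  shows "mpoly_compose f p \<in> polys_in W"
  unfolding mpoly_compose.subst_def monom_prod_def
  using assms(1) by (intro polys_in_intros assms(2)) (auto simp: polys_in_def)

lemma eval_mpoly_cong:
  assumes "p \<in> polys_in V" "\<And>i. i \<in> V \<Longrightarrow> x i = y i"
  shows "eval_mpoly p x = eval_mpoly p y"
  unfolding eval_mpoly_def eval_monom_def
  using assms by (intro sum.cong prod.cong arg_cong2[where f = "(*)"] refl)
    (auto simp: polys_in_def subset_iff)

lemma horner_decomposition:
  assumes "p \<in> polys_in (insert k V)"
  obtains p\<^sub>0 q where "p = p\<^sub>0 + Var k * q" "p\<^sub>0 \<in> polys_in V" "q \<in> polys_in (insert k V)"
    "\<And>n. \<forall>m\<in>keys p. lookup m k < Suc n \<Longrightarrow> \<forall>m\<in>keys q. lookup m k < n"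
proof
  let ?K = "{m\<in>keys p. k \<in> keys m}"
  define p\<^sub>0 where "p\<^sub>0 = (\<Sum>m\<in>keys p - ?K. single m (lookup p m))"
  define q where "q = (\<Sum>m\<in>?K. single (m - single k 1) (lookup p m))"
  have "Var k * single (m - single k 1) c = single m c" if "k \<in> keys m" for m and c :: complex
  proof -
    have "single k 1 + (m - single k 1) = m"
      using that by (intro poly_mapping_eqI)
        (auto simp: lookup_add lookup_minus lookup_single when_def in_keys_iff)
    then show ?thesis by (simp add: Var_def mult_single)
  qed
  then have "Var k * q = (\<Sum>m\<in>?K. single m (lookup p m))"
    by (simp add: q_def sum_distrib_left)
  then show "p = p\<^sub>0 + Var k * q"
    using sum.subset_diff[of ?K "keys p" "\<lambda>m. single m (lookup p m)"]
    by (simp add: p\<^sub>0_def sum_single_lookup)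
  show "p\<^sub>0 \<in> polys_in V"
    unfolding p\<^sub>0_def using assms by (intro polys_in_sum polys_in_single) (auto simp: polys_in_def)
  have "keys (m - single k 1) \<subseteq> keys m" for m :: monom
    by (auto simp: in_keys_iff lookup_minus)
  then show "q \<in> polys_in (insert k V)"
    unfolding q_def using assms by (intro polys_in_sum polys_in_single) (force simp: polys_in_def)
  fix n assume "\<forall>m\<in>keys p. lookup m k < Suc n"
  then show "\<forall>m\<in>keys q. lookup m k < n"
    using keys_sum[of "\<lambda>m. single (m - single k 1) (lookup p m)" ?K]
    by (fastforce simp: q_def lookup_minus in_keys_iff split: if_splits)
qed

lemma polys_in_insert_induct [consumes 1, case_names zero horner]:
  assumes "p \<in> polys_in (insert k V)"
    and zero: "P 0"
    and horner: "\<And>p\<^sub>0 q. p\<^sub>0 \<in> polys_in V \<Longrightarrow> q \<in> polys_in (insert k V) \<Longrightarrow> P q \<Longrightarrow> P (p\<^sub>0 + Var k * q)"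
  shows "P p"
proof -
  have "P p" if "p \<in> polys_in (insert k V)" "\<forall>m\<in>keys p. lookup m k < n" for n p
    using that
  proof (induction n arbitrary: p)
    case 0
    then have "keys p = {}" by auto
    then show ?case using zero by simp
  next
    case (Suc n)
    obtain p\<^sub>0 q where "p = p\<^sub>0 + Var k * q" "p\<^sub>0 \<in> polys_in V" "q \<in> polys_in (insert k V)"
      "\<forall>m\<in>keys q. lookup m k < n"
      by (rule horner_decomposition[OF Suc.prems(1)]) (use Suc.prems(2) in blast)
    then show ?case using Suc.IH horner by simp
  qed
  moreover have "\<forall>m\<in>keys p. lookup m k < Suc (\<Sum>m\<in>keys p. lookup m k)"
    by (auto simp: less_Suc_eq_le intro: member_le_sum)
  ultimately show ?thesis using assms(1) by blast
qed

section \<open>Real images of polynomial maps\<close>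

lemma poly_eq_0_if_zero_on_reals:
  fixes P :: "complex poly"
  assumes "\<And>r :: real. poly P (of_real r) = 0"
  shows "P = 0"
proof (rule ccontr)
  assume "P \<noteq> 0"
  then have "finite {z. poly P z = 0}" by (rule poly_roots_finite)
  moreover have "range complex_of_real \<subseteq> {z. poly P z = 0}" using assms by auto
  ultimately have "finite (range complex_of_real)" by (rule finite_subset[rotated])
  then show False
    using infinite_UNIV_char_0[where 'a = real] inj_of_real finite_imageD by blast
qed

lemma eval_mpoly_eq_0_if_mult_coordinate_eq_0:
  fixes y :: "nat \<Rightarrow> real"
  assumes "\<And>y :: nat \<Rightarrow> real. of_real (y k) * eval_mpoly q (\<lambda>i. of_real (y i)) = 0"
  shows "eval_mpoly q (\<lambda>i. of_real (y i)) = 0"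
proof -
  interpret univariate: coeff_hom "\<lambda>c :: complex. [:c:]" by unfold_locales auto
  define Q where "Q = univariate.subst (\<lambda>i. if i = k then [:0, 1:] else [:of_real (y i):]) q"
  have poly_Q: "poly Q (of_real r) = eval_mpoly q (\<lambda>i. of_real ((y(k := r)) i))" for r
    unfolding Q_def by (subst univariate.eval_subst[where e = "\<lambda>P. poly P (of_real r)"])
      (auto intro!: arg_cong[where f = "eval_mpoly q"])
  have "[:0, 1:] * Q = 0"
    by (rule poly_eq_0_if_zero_on_reals) (use assms[of "y(k := _)"] in \<open>simp add: poly_Q\<close>)
  then have "Q = 0" by simp
  then show ?thesis using poly_Q[of "y k"] by simp
qed

lemma mpoly_eq_0_if_zero_on_reals:
  assumes "\<And>y :: nat \<Rightarrow> real. eval_mpoly p (\<lambda>i. of_real (y i)) = 0"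
  shows "p = 0"
proof -
  obtain V where "finite V" "p \<in> polys_in V" using polys_in_finite_vars by blast
  then show ?thesis using assms
  proof (induction V arbitrary: p)
    case empty
    then show ?case using polys_in_empty[of p]
      by (metis eval_mpoly.subst_single monom_prod_zero mult_1_right single_zero)
  next
    case (insert k V)
    from insert.prems(1) have "(\<forall>y :: nat \<Rightarrow> real. eval_mpoly p (\<lambda>i. of_real (y i)) = 0) \<longrightarrow> p = 0"
    proof (induction p rule: polys_in_insert_induct)
      case (horner p\<^sub>0 q)
      show ?case
      proof
        assume zero: "\<forall>y :: nat \<Rightarrow> real. eval_mpoly (p\<^sub>0 + Var k * q) (\<lambda>i. of_real (y i)) = 0"
        have "eval_mpoly p\<^sub>0 (\<lambda>i. of_real (y i)) = 0" for y :: "nat \<Rightarrow> real"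
        proof -
          have "eval_mpoly p\<^sub>0 (\<lambda>i. of_real (y i)) = eval_mpoly p\<^sub>0 (\<lambda>i. of_real ((y(k := 0)) i))"
            using insert.hyps by (intro eval_mpoly_cong[OF horner.hyps(1)]) auto
          then show ?thesis using zero[rule_format, of "y(k := 0)"] by simp
        qed
        then have "p\<^sub>0 = 0" using insert.IH[OF horner.hyps(1)] by blast
        then have "eval_mpoly q (\<lambda>i. of_real (y i)) = 0" for y :: "nat \<Rightarrow> real"
          using zero by (intro eval_mpoly_eq_0_if_mult_coordinate_eq_0[of k]) simp
        then show "p\<^sub>0 + Var k * q = 0" using horner.IH \<open>p\<^sub>0 = 0\<close> by simp
      qed
    qed simp
    then show ?case using insert.prems(2) by blast
  qed
qed

definition real_image :: "(nat \<Rightarrow> mpoly) \<Rightarrow> (nat \<Rightarrow> complex) set" where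
  "real_image \<phi> = range (\<lambda>(y :: nat \<Rightarrow> real) i. eval_mpoly (\<phi> i) (\<lambda>j. of_real (y j)))"

lemma zero_on_real_image_iff:
  "(\<forall>x\<in>real_image \<phi>. eval_mpoly p x = 0) \<longleftrightarrow> mpoly_compose \<phi> p = 0"
proof
  assume "\<forall>x\<in>real_image \<phi>. eval_mpoly p x = 0"
  then show "mpoly_compose \<phi> p = 0"
    by (intro mpoly_eq_0_if_zero_on_reals) (auto simp: real_image_def eval_mpoly_compose)
qed (auto simp: real_image_def simp flip: eval_mpoly_compose)

section \<open>Ideals and the Zariski topology\<close>

lemma is_ideal_ideal_gen:
  assumes "S \<subseteq> polyring d"
  shows "is_ideal_in (polyring d) (ideal_gen d S)"
proof -
  have "is_ideal_in (polyring d) (polyring d)"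
    by (simp add: is_ideal_in_def polyring_eq polys_in_intros)
  then have "ideal_gen d S \<subseteq> polyring d"
    unfolding ideal_gen_def using assms by blast
  then show ?thesis
    unfolding is_ideal_in_def ideal_gen_def by blast
qed

lemma ideal_gen_base: "S \<subseteq> ideal_gen d S"
  by (auto simp: ideal_gen_def)

lemma ideal_gen_least: "is_ideal_in (polyring d) J \<Longrightarrow> S \<subseteq> J \<Longrightarrow> ideal_gen d S \<subseteq> J"
  by (auto simp: ideal_gen_def)

lemma ideal_diff:
  assumes "is_ideal_in (polyring d) J" "a \<in> J" "b \<in> J"
  shows "a - b \<in> J"
proof -
  have "- 1 \<in> polyring d"
    by (simp add: polyring_eq polys_in_intros)
  then have "(- 1) * b \<in> J"
    using assms unfolding is_ideal_in_def by blast
  then show ?thesis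
    using assms unfolding is_ideal_in_def by (metis diff_conv_add_uminus mult_minus1)
qed

lemma ideal_sum:
  assumes "is_ideal_in (polyring d) J" "\<And>i. i \<in> A \<Longrightarrow> p i \<in> J"
  shows "sum p A \<in> J"
  using assms(2) by (induction A rule: infinite_finite_induct)
    (use assms(1) in \<open>auto simp: is_ideal_in_def\<close>)

lemma is_ideal_vanishing_ideal: "is_ideal_in (polyring d) (vanishing_ideal d Z)"
  by (auto simp: is_ideal_in_def vanishing_ideal_def polyring_eq polys_in_intros)

lemma vanishing_ideal_antimono: "S \<subseteq> T \<Longrightarrow> vanishing_ideal d T \<subseteq> vanishing_ideal d S"
  by (auto simp: vanishing_ideal_def)

lemma zariski_closed_zero_set: "S \<subseteq> polyring d \<Longrightarrow> zariski_closed d (zero_set d S)"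
  by (auto simp: zariski_closed_def)

lemma zariski_closed_psubset_separated:
  assumes "zariski_closed d A" "zariski_closed d B" "A \<subset> B"
  obtains f where "f \<in> vanishing_ideal d A" "f \<notin> vanishing_ideal d B"
proof -
  obtain x where x: "x \<in> B" "x \<notin> A" using assms(3) by blast
  then have "x \<in> aspace d" using assms(2) by (auto simp: zariski_closed_def zero_set_def)
  then obtain f where "f \<in> vanishing_ideal d A" "eval_mpoly f x \<noteq> 0"
    using assms(1) x(2) unfolding zariski_closed_def zero_set_def vanishing_ideal_def by blast
  then show thesis using x(1) by (intro that) (auto simp: vanishing_ideal_def)
qed

lemma zariski_closure_eq:
  assumes "S \<subseteq> aspace d"
  shows "zariski_closure d S = zero_set d (vanishing_ideal d S)"
proof
  have "zariski_closed d (zero_set d (vanishing_ideal d S))"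
    by (rule zariski_closed_zero_set) (auto simp: vanishing_ideal_def)
  moreover have "S \<subseteq> zero_set d (vanishing_ideal d S)"
    using assms by (auto simp: vanishing_ideal_def zero_set_def)
  ultimately show "zariski_closure d S \<subseteq> zero_set d (vanishing_ideal d S)"
    by (auto simp: zariski_closure_def)
  show "zero_set d (vanishing_ideal d S) \<subseteq> zariski_closure d S"
    by (fastforce simp: zariski_closure_def zariski_closed_def zero_set_def vanishing_ideal_def)
qed

lemma zariski_closed_closure: "S \<subseteq> aspace d \<Longrightarrow> zariski_closed d (zariski_closure d S)"
  unfolding zariski_closure_eq by (rule zariski_closed_zero_set) (auto simp: vanishing_ideal_def)

lemma subset_zariski_closure: "S \<subseteq> zariski_closure d S"
  by (auto simp: zariski_closure_def)

lemma zariski_closure_mono: "S \<subseteq> T \<Longrightarrow> zariski_closure d S \<subseteq> zariski_closure d T"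
  by (auto simp: zariski_closure_def)

lemma vanishing_ideal_zariski_closure:
  assumes "S \<subseteq> aspace d"
  shows "vanishing_ideal d (zariski_closure d S) = vanishing_ideal d S"
  unfolding zariski_closure_eq[OF assms]
  using assms by (auto simp: vanishing_ideal_def zero_set_def)

lemma zariski_closure_psubset:
  assumes "S \<subseteq> T" "T \<subseteq> aspace d"
    and "f \<in> vanishing_ideal d S" "f \<notin> vanishing_ideal d T"
  shows "zariski_closure d S \<subset> zariski_closure d T"
proof
  have "S \<subseteq> aspace d" using assms by blast
  then have "vanishing_ideal d (zariski_closure d S) \<noteq> vanishing_ideal d (zariski_closure d T)"
    using assms vanishing_ideal_zariski_closure by blast
  then show "zariski_closure d S \<noteq> zariski_closure d T" by metis
qed (rule zariski_closure_mono[OF assms(1)])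

definition irreducible_on :: "nat \<Rightarrow> (nat \<Rightarrow> complex) set \<Rightarrow> bool" where
  "irreducible_on d S \<longleftrightarrow> S \<noteq> {} \<and>
     (\<forall>f\<in>polyring d. \<forall>g\<in>polyring d. f * g \<in> vanishing_ideal d S \<longrightarrow>
        f \<in> vanishing_ideal d S \<or> g \<in> vanishing_ideal d S)"

lemma prime_ideal_vanishing_ideal:
  assumes "irreducible_on d S"
  shows "prime_ideal d (vanishing_ideal d S)"
proof -
  have "1 \<in> polyring d" "1 \<notin> vanishing_ideal d S"
    using assms by (auto simp: irreducible_on_def vanishing_ideal_def polyring_eq polys_in_one)
  then have "vanishing_ideal d S \<noteq> polyring d" by blast
  then show ?thesis
    using assms is_ideal_vanishing_ideal unfolding prime_ideal_def irreducible_on_def by blast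
qed

lemma irreducible_closed_zariski_closure:
  assumes "irreducible_on d S" "S \<subseteq> aspace d"
  shows "irreducible_closed d (zariski_closure d S)"
  unfolding irreducible_closed_def
proof (intro conjI allI impI)
  show "zariski_closed d (zariski_closure d S)" by (rule zariski_closed_closure) fact
  show "zariski_closure d S \<noteq> {}"
    using assms subset_zariski_closure[of S d] by (auto simp: irreducible_on_def)
  fix A B assume "zariski_closed d A \<and> zariski_closed d B \<and> zariski_closure d S = A \<union> B"
  then have AB: "zariski_closed d A" "zariski_closed d B" "zariski_closure d S = A \<union> B" by auto
  show "zariski_closure d S = A \<or> zariski_closure d S = B"
  proof (rule ccontr)
    assume "\<not> ?thesis"
    then have psubset: "A \<subset> zariski_closure d S" "B \<subset> zariski_closure d S"
      using AB(3) by blast+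
    note closed = zariski_closed_closure[OF assms(2)]
      and same_ideal = vanishing_ideal_zariski_closure[OF assms(2)]
    obtain f where f: "f \<in> vanishing_ideal d A" "f \<notin> vanishing_ideal d S"
      using zariski_closed_psubset_separated[OF AB(1) closed psubset(1)]
      unfolding same_ideal by blast
    obtain g where g: "g \<in> vanishing_ideal d B" "g \<notin> vanishing_ideal d S"
      using zariski_closed_psubset_separated[OF AB(2) closed psubset(2)]
      unfolding same_ideal by blast
    have poly: "f \<in> polyring d" "g \<in> polyring d"
      using f(1) g(1) by (auto simp: vanishing_ideal_def)
    have "\<forall>z\<in>S. eval_mpoly (f * g) z = 0"
      using f(1) g(1) AB(3) subset_zariski_closure[of S d] by (auto simp: vanishing_ideal_def)
    then have "f * g \<in> vanishing_ideal d S"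
      using poly by (simp add: vanishing_ideal_def polyring_eq polys_in_mult)
    then show False
      using assms(1) poly f(2) g(2) unfolding irreducible_on_def by blast
  qed
qed

lemma irreducible_closed_imp_irreducible_on:
  assumes "irreducible_closed d Z"
  shows "irreducible_on d Z"
  unfolding irreducible_on_def
proof (intro conjI ballI impI)
  show "Z \<noteq> {}" using assms by (simp add: irreducible_closed_def)
  fix f g assume fg: "f \<in> polyring d" "g \<in> polyring d" "f * g \<in> vanishing_ideal d Z"
  obtain S where S: "S \<subseteq> polyring d" "Z = zero_set d S"
    using assms by (auto simp: irreducible_closed_def zariski_closed_def)
  have "Z = zero_set d (insert f S) \<union> zero_set d (insert g S)"
    using fg S by (auto simp: zero_set_def vanishing_ideal_def)
  moreover have "zariski_closed d (zero_set d (insert f S))"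
    "zariski_closed d (zero_set d (insert g S))"
    using fg S by (auto intro!: zariski_closed_zero_set)
  ultimately have "Z = zero_set d (insert f S) \<or> Z = zero_set d (insert g S)"
    using assms unfolding irreducible_closed_def by blast
  then show "f \<in> vanishing_ideal d Z \<or> g \<in> vanishing_ideal d Z"
    using fg by (auto simp: zero_set_def vanishing_ideal_def)
qed

lemma vanishing_ideal_real_image:
  "vanishing_ideal d (real_image \<phi>) = {p \<in> polyring d. mpoly_compose \<phi> p = 0}"
  unfolding vanishing_ideal_def zero_on_real_image_iff ..

lemma vanishing_ideal_real_image_not_subset:
  assumes "i \<le> d" "\<phi> i = 0" "\<psi> i \<noteq> 0"
  shows "\<not> vanishing_ideal d (real_image \<phi>) \<subseteq> vanishing_ideal d (real_image \<psi>)"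
proof
  assume "vanishing_ideal d (real_image \<phi>) \<subseteq> vanishing_ideal d (real_image \<psi>)"
  moreover have "Var i \<in> vanishing_ideal d (real_image \<phi>)"
    using assms by (simp add: vanishing_ideal_real_image polyring_eq polys_in_Var)
  ultimately have "Var i \<in> vanishing_ideal d (real_image \<psi>)" by blast
  then show False using assms(3) by (simp add: vanishing_ideal_real_image)
qed

lemma irreducible_on_real_image: "irreducible_on d (real_image \<phi>)"
  unfolding irreducible_on_def by (auto simp: vanishing_ideal_real_image) (simp add: real_image_def)

section \<open>Transcendence degree bounds the length of chains\<close>

definition algebraically_independent_on ::
  "(nat \<Rightarrow> complex) set \<Rightarrow> nat set \<Rightarrow> (nat \<Rightarrow> mpoly) \<Rightarrow> bool" where
  "algebraically_independent_on S V f \<longleftrightarrow>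
     (\<forall>P\<in>polys_in V. (\<forall>x\<in>S. eval_mpoly (mpoly_compose f P) x = 0) \<longrightarrow> P = 0)"

lemma algebraically_independent_on_mono:
  "algebraically_independent_on S V f \<Longrightarrow> S \<subseteq> T \<Longrightarrow> algebraically_independent_on T V f"
  unfolding algebraically_independent_on_def by blast

lemma algebraically_independent_on_empty:
  assumes "S \<noteq> {}"
  shows "algebraically_independent_on S {} f"
  unfolding algebraically_independent_on_def
proof (intro ballI impI)
  fix P assume "P \<in> polys_in {}" "\<forall>x\<in>S. eval_mpoly (mpoly_compose f P) x = 0"
  moreover obtain x where "x \<in> S" using assms by blast
  ultimately show "P = 0"
    by (metis eval_mpoly_compose eval_mpoly.subst_single monom_prod_zero mult_1_right
        polys_in_empty single_zero)
qed

text \<open>In a relation \<open>P\<^sub>0 + f\<^sub>k Q = 0\<close> on \<open>T\<close> the term \<open>P\<^sub>0\<close> vanishes on \<open>S\<close>, hence is zero, and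
  then irreducibility of \<open>T\<close> cancels \<open>f\<^sub>k\<close>.\<close>

lemma algebraically_independent_on_insert:
  assumes indep: "algebraically_independent_on S V f"
    and "S \<subseteq> T" and irr: "irreducible_on d T"
    and poly: "\<And>i. i \<in> insert k V \<Longrightarrow> f i \<in> polyring d"
    and fk: "f k \<in> vanishing_ideal d S" "f k \<notin> vanishing_ideal d T"
  shows "algebraically_independent_on T (insert k V) f"
  unfolding algebraically_independent_on_def
proof
  fix P assume "P \<in> polys_in (insert k V)"
  then show "(\<forall>x\<in>T. eval_mpoly (mpoly_compose f P) x = 0) \<longrightarrow> P = 0"
  proof (induction P rule: polys_in_insert_induct)
    case (horner P\<^sub>0 Q)
    show ?case
    proof
      assume zero: "\<forall>x\<in>T. eval_mpoly (mpoly_compose f (P\<^sub>0 + Var k * Q)) x = 0"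
      have "eval_mpoly (mpoly_compose f P\<^sub>0) x = 0" if "x \<in> S" for x
      proof -
        have "x \<in> T" "eval_mpoly (f k) x = 0"
          using that \<open>S \<subseteq> T\<close> fk(1) by (auto simp: vanishing_ideal_def)
        then show ?thesis using zero[rule_format, of x] by simp
      qed
      then have "P\<^sub>0 = 0"
        using indep horner.hyps(1) by (simp add: algebraically_independent_on_def)
      moreover have "mpoly_compose f Q \<in> polyring d" "f k \<in> polyring d"
        using poly horner.hyps(2) unfolding polyring_eq by (auto intro: polys_in_compose)
      ultimately have "mpoly_compose f Q \<in> vanishing_ideal d T"
        using irr fk(2) zero unfolding irreducible_on_def
        by (auto simp: vanishing_ideal_def polyring_eq polys_in_mult)
      then show "P\<^sub>0 + Var k * Q = 0"
        using horner.IH \<open>P\<^sub>0 = 0\<close> by (simp add: vanishing_ideal_def)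
    qed
  qed simp
qed

lemma irr_chain_imp_algebraically_independent_on:
  assumes "irr_chain d V n"
  obtains f where "\<And>i. i < n \<Longrightarrow> f i \<in> polyring d" "algebraically_independent_on V {..<n} f"
proof -
  obtain Z where Z: "\<And>k. k \<le> n \<Longrightarrow> irreducible_closed d (Z k) \<and> Z k \<subseteq> V"
    "\<And>k. k < n \<Longrightarrow> Z k \<subset> Z (Suc k)"
    using assms unfolding irr_chain_def by blast
  have irr: "irreducible_on d (Z k)" if "k \<le> n" for k
    using Z(1)[OF that] irreducible_closed_imp_irreducible_on by blast
  have "\<exists>f. f \<in> vanishing_ideal d (Z k) \<and> f \<notin> vanishing_ideal d (Z (Suc k))" if k: "k < n" for k
  proof -
    have "zariski_closed d (Z k)" "zariski_closed d (Z (Suc k))"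
      using Z(1)[of k] Z(1)[of "Suc k"] k by (auto simp: irreducible_closed_def)
    then show ?thesis using Z(2)[OF k] zariski_closed_psubset_separated by metis
  qed
  then obtain f where f: "\<And>k. k < n \<Longrightarrow>
      f k \<in> vanishing_ideal d (Z k) \<and> f k \<notin> vanishing_ideal d (Z (Suc k))"
    by metis
  have poly: "f i \<in> polyring d" if "i < n" for i
    using f[OF that] by (simp add: vanishing_ideal_def)
  have "algebraically_independent_on (Z k) {..<k} f" if "k \<le> n" for k
    using that
  proof (induction k)
    case 0
    then show ?case
      using irr[of 0] by (simp add: algebraically_independent_on_empty irreducible_on_def)
  next
    case (Suc k)
    then have "algebraically_independent_on (Z (Suc k)) (insert k {..<k}) f"
      using f[of k] Z(2)[of k] irr[of "Suc k"] poly
      by (intro algebraically_independent_on_insert[of "Z k"]) auto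
    then show ?case by (simp add: lessThan_Suc)
  qed
  then have "algebraically_independent_on V {..<n} f"
    using Z(1)[of n] algebraically_independent_on_mono by blast
  with poly show thesis by (rule that)
qed

lemma irr_chain_real_images:
  assumes aspace: "\<And>k. k \<le> n \<Longrightarrow> real_image (\<phi> k) \<subseteq> aspace d"
    and sub: "\<And>k. k < n \<Longrightarrow> real_image (\<phi> k) \<subseteq> real_image (\<phi> (Suc k))"
    and strict: "\<And>k. k < n \<Longrightarrow>
      \<not> vanishing_ideal d (real_image (\<phi> k)) \<subseteq> vanishing_ideal d (real_image (\<phi> (Suc k)))"
  shows "irr_chain d (zariski_closure d (real_image (\<phi> n))) n"
  unfolding irr_chain_def
proof (intro exI[of _ "\<lambda>k. zariski_closure d (real_image (\<phi> k))"] conjI allI impI)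
  show "zariski_closure d (real_image (\<phi> k)) \<subset> zariski_closure d (real_image (\<phi> (Suc k)))"
    if k: "k < n" for k
  proof -
    obtain f where "f \<in> vanishing_ideal d (real_image (\<phi> k))"
      "f \<notin> vanishing_ideal d (real_image (\<phi> (Suc k)))"
      using strict[OF k] by blast
    then show ?thesis using sub[OF k] aspace[of "Suc k"] k by (intro zariski_closure_psubset) auto
  qed
  fix k assume "k \<le> n"
  then show "irreducible_closed d (zariski_closure d (real_image (\<phi> k)))"
    using irreducible_on_real_image aspace by (intro irreducible_closed_zariski_closure)
  from \<open>k \<le> n\<close> have "real_image (\<phi> k) \<subseteq> real_image (\<phi> n)"
    by (induction k rule: inc_induct) (use sub in blast)+
  then show "zariski_closure d (real_image (\<phi> k)) \<subseteq> zariski_closure d (real_image (\<phi> n))"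
    by (rule zariski_closure_mono)
qed

section \<open>More polynomials than variables are algebraically dependent\<close>

definition box :: "nat set \<Rightarrow> nat \<Rightarrow> monom set" where
  "box V N = {m. keys m \<subseteq> V \<and> (\<forall>i. lookup m i \<le> N)}"

lemma bij_betw_box:
  assumes "finite V"
  shows "bij_betw (\<lambda>m. restrict (lookup m) V) (box V N) (V \<rightarrow>\<^sub>E {..N})"
proof (rule bij_betwI[where g = "\<lambda>f. Abs_poly_mapping (\<lambda>i. if i \<in> V then f i else 0)"])
  have lookup_Abs: "lookup (Abs_poly_mapping (\<lambda>i. if i \<in> V then f i else 0)) i =
      (if i \<in> V then f i else 0)"
    for f :: "nat \<Rightarrow> nat" and i
    using assms by simp
  show "(\<lambda>m. restrict (lookup m) V) \<in> box V N \<rightarrow> (V \<rightarrow>\<^sub>E {..N})"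
    by (auto simp: box_def)
  show "(\<lambda>f. Abs_poly_mapping (\<lambda>i. if i \<in> V then f i else 0)) \<in> (V \<rightarrow>\<^sub>E {..N}) \<rightarrow> box V N"
    by (auto simp: box_def in_keys_iff lookup_Abs split: if_splits)
  show "Abs_poly_mapping (\<lambda>i. if i \<in> V then restrict (lookup m) V i else 0) = m"
    if "m \<in> box V N" for m
    using that by (intro poly_mapping_eqI) (auto simp: box_def lookup_Abs in_keys_iff)
  show "restrict (lookup (Abs_poly_mapping (\<lambda>i. if i \<in> V then f i else 0))) V = f"
    if "f \<in> V \<rightarrow>\<^sub>E {..N}" for f
    using that by (auto simp: lookup_Abs restrict_def PiE_def extensional_def)
qed

lemma finite_box: "finite V \<Longrightarrow> finite (box V N)"
  using bij_betw_finite[OF bij_betw_box] by (simp add: finite_PiE)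

lemma card_box: "finite V \<Longrightarrow> card (box V N) = Suc N ^ card V"
  using bij_betw_same_card[OF bij_betw_box] by (simp add: card_PiE)

lemma keys_mult_box:
  assumes "keys p \<subseteq> box V M" "keys q \<subseteq> box V N"
  shows "keys (p * q) \<subseteq> box V (M + N)"
proof
  fix m assume "m \<in> keys (p * q)"
  then obtain a b where "m = a + b" "a \<in> box V M" "b \<in> box V N"
    using keys_mult[of p q] assms by blast
  moreover from this have "keys m \<subseteq> V"
    using keys_add[of a b] by (fastforce simp: box_def)
  ultimately show "m \<in> box V (M + N)"
    by (simp add: box_def lookup_add add_mono)
qed

lemma keys_power_box:
  assumes "keys p \<subseteq> box V N"
  shows "keys (p ^ k) \<subseteq> box V (k * N)"
proof (induction k)
  case (Suc k)
  then show ?case using keys_mult_box[OF assms Suc.IH] by simp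
qed (simp add: box_def)

lemma box_mono: "M \<le> N \<Longrightarrow> box V M \<subseteq> box V N"
  by (auto simp: box_def intro: order.trans)

lemma keys_monom_prod_box:
  assumes "\<And>i. i \<in> V \<Longrightarrow> keys (f i) \<subseteq> box W D" "finite V" "m \<in> box V N"
  shows "keys (monom_prod f m) \<subseteq> box W (card V * N * D)"
proof -
  have "keys (\<Prod>i\<in>A. f i ^ lookup m i) \<subseteq> box W (card A * N * D)" if "finite A" "A \<subseteq> V" for A
    using that
  proof (induction A rule: finite_induct)
    case empty
    then show ?case by (simp add: box_def)
  next
    case (insert i A)
    have "keys (f i ^ lookup m i) \<subseteq> box W (lookup m i * D)"
      using insert.prems assms(1) by (intro keys_power_box) auto
    also have "\<dots> \<subseteq> box W (N * D)"
      using assms(3) by (intro box_mono mult_right_mono) (auto simp: box_def)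
    finally show ?case
      using insert keys_mult_box[of "f i ^ lookup m i" W "N * D" _ "card A * N * D"]
      by (simp add: distrib_right)
  qed
  moreover have "monom_prod f m = (\<Prod>i\<in>V. f i ^ lookup m i)"
    using assms by (intro monom_prod_superset) (auto simp: box_def)
  ultimately show ?thesis using assms(2) by simp
qed

lemma polys_in_bounded_exponents:
  assumes "finite V" "\<And>i. i \<in> V \<Longrightarrow> f i \<in> polys_in W"
  obtains D where "\<And>i. i \<in> V \<Longrightarrow> keys (f i) \<subseteq> box W D"
proof -
  let ?E = "\<Union>i\<in>V. \<Union>m\<in>keys (f i). lookup m ` keys m"
  have "lookup m j \<le> Max (insert 0 ?E)" if "i \<in> V" "m \<in> keys (f i)" for i m j
  proof (rule Max_ge)
    show "lookup m j \<in> insert 0 ?E"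
      using that by (cases "j \<in> keys m") (auto simp: not_in_keys_iff_lookup_eq_zero)
  qed (use assms(1) in simp)
  then have "keys (f i) \<subseteq> box W (Max (insert 0 ?E))" if "i \<in> V" for i
    using assms(2)[OF that] that by (auto simp: box_def polys_in_def)
  then show thesis by (rule that)
qed

lemma (in vector_space) nontrivial_combination_eq_0:
  assumes "finite S" "finite T" "card T < card S" "g ` S \<subseteq> span T"
  obtains c where "\<exists>s\<in>S. c s \<noteq> 0" "(\<Sum>s\<in>S. c s *s g s) = 0"
proof (cases "inj_on g S")
  case False
  then obtain s t where st: "s \<in> S" "t \<in> S" "s \<noteq> t" "g s = g t" by (auto simp: inj_on_def)
  let ?c = "\<lambda>r. if r = s then 1 else if r = t then - 1 else 0"
  have "(\<Sum>r\<in>S. ?c r *s g r) = (\<Sum>r\<in>{s, t}. ?c r *s g r)"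
    using st \<open>finite S\<close> by (intro sum.mono_neutral_right) auto
  also have "\<dots> = 0" using st by simp
  finally show thesis using st by (intro that[of ?c]) auto
next
  case True
  have "dependent (g ` S)"
    using independent_span_bound[OF \<open>finite T\<close> _ assms(4)] assms(3) card_image[OF True] by auto
  then obtain c where "\<exists>v\<in>g ` S. c v \<noteq> 0" "(\<Sum>v\<in>g ` S. c v *s v) = 0"
    using dependent_finite[of "g ` S"] \<open>finite S\<close> by auto
  then show thesis by (intro that[of "c \<circ> g"]) (auto simp: sum.reindex[OF True])
qed

interpretation mpoly: vector_space "\<lambda>(c :: complex) (p :: mpoly). single 0 c * p"
  by unfold_locales
    (simp_all add: single_add distrib_left distrib_right mult_single flip: mult.assoc)

lemma mpoly_in_span_singles:
  assumes "keys p \<subseteq> B"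
  shows "p \<in> mpoly.span ((\<lambda>m. single m 1) ` B)"
proof -
  have "(\<Sum>m\<in>keys p. single 0 (lookup p m) * single m 1) \<in> mpoly.span ((\<lambda>m. single m 1) ` B)"
    using assms by (intro mpoly.span_sum mpoly.span_scale mpoly.span_base) auto
  then show ?thesis by (simp add: mult_single sum_single_lookup)
qed

text \<open>The monomials in the \<open>f\<^sub>i\<close> with exponents at most \<open>N\<close> number \<open>(N + 1)\<^bsup>card V\<^esup>\<close>, but they
  lie in a space of dimension \<open>O(N\<^bsup>card W\<^esup>)\<close>.\<close>

lemma algebraically_dependent_if_more_than_variables:
  assumes fin: "finite V" "finite W" and "card W < card V"
    and f: "\<And>i. i \<in> V \<Longrightarrow> f i \<in> polys_in W"
  obtains P where "P \<in> polys_in V" "P \<noteq> 0" "mpoly_compose f P = 0"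
proof -
  obtain D where D: "\<And>i. i \<in> V \<Longrightarrow> keys (f i) \<subseteq> box W D"
    using polys_in_bounded_exponents[OF fin(1)] f by blast
  define N where "N = Suc (card V * D) ^ card W"
  define M where "M = card V * N * D"
  have "card ((\<lambda>m. single m 1 :: mpoly) ` box W M) \<le> Suc M ^ card W"
    using card_image_le[OF finite_box[OF fin(2)]] card_box[OF fin(2)] by metis
  also have "\<dots> \<le> (Suc (card V * D) * Suc N) ^ card W"
    unfolding M_def by (intro power_mono) (simp_all add: algebra_simps)
  also have "\<dots> = N * Suc N ^ card W" by (simp only: N_def power_mult_distrib)
  also have "\<dots> < Suc N ^ Suc (card W)" by simp
  also have "\<dots> \<le> Suc N ^ card V" using assms(3) by (intro power_increasing) auto
  also have "\<dots> = card (box V N)" by (simp add: card_box fin)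
  finally have card: "card ((\<lambda>m. single m 1 :: mpoly) ` box W M) < card (box V N)" .
  have span: "monom_prod f ` box V N \<subseteq> mpoly.span ((\<lambda>m. single m 1) ` box W M)"
    unfolding M_def by (intro image_subsetI mpoly_in_span_singles keys_monom_prod_box D fin(1))
  obtain c where c: "\<exists>m\<in>box V N. c m \<noteq> 0" "(\<Sum>m\<in>box V N. single 0 (c m) * monom_prod f m) = 0"
    by (rule mpoly.nontrivial_combination_eq_0[OF finite_box[OF fin(1)]
          finite_imageI[OF finite_box[OF fin(2)]] card span])
  define P where "P = (\<Sum>m\<in>box V N. single m (c m))"
  have "lookup P m = (if m \<in> box V N then c m else 0)" for m
    using finite_box[OF fin(1)] by (simp add: P_def lookup_sum lookup_single when_def)
  then have "P \<noteq> 0" using c(1) by (metis lookup_zero)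
  moreover have "P \<in> polys_in V"
    unfolding P_def by (intro polys_in_sum polys_in_single) (simp add: box_def)
  moreover have "mpoly_compose f P = 0" using c(2) by (simp add: P_def)
  ultimately show thesis by (intro that)
qed

lemma irr_chain_zariski_closure_real_image_le:
  assumes W: "finite W" "\<And>i. \<phi> i \<in> polys_in W" and aspace: "real_image \<phi> \<subseteq> aspace d"
    and chain: "irr_chain d (zariski_closure d (real_image \<phi>)) n"
  shows "n \<le> card W"
proof (rule ccontr)
  assume "\<not> n \<le> card W"
  let ?V = "zariski_closure d (real_image \<phi>)"
  obtain f where f: "\<And>i. i < n \<Longrightarrow> f i \<in> polyring d"
    and indep: "algebraically_independent_on ?V {..<n} f"
    using irr_chain_imp_algebraically_independent_on[OF chain] by blast
  have "mpoly_compose \<phi> (f i) \<in> polys_in W" if "i < n" for i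
    using f[OF that] W(2) unfolding polyring_eq by (rule polys_in_compose)
  then obtain P where P: "P \<in> polys_in {..<n}" "P \<noteq> 0"
    "mpoly_compose (\<lambda>i. mpoly_compose \<phi> (f i)) P = 0"
    using algebraically_dependent_if_more_than_variables[of "{..<n}" W] \<open>\<not> n \<le> card W\<close> W(1)
    by (metis card_lessThan finite_lessThan lessThan_iff not_le)
  then have "mpoly_compose \<phi> (mpoly_compose f P) = 0"
    by (simp add: mpoly_compose_compose)
  moreover have "mpoly_compose f P \<in> polyring d"
    using P(1) f unfolding polyring_eq by (auto intro: polys_in_compose)
  ultimately have "mpoly_compose f P \<in> vanishing_ideal d ?V"
    by (simp add: vanishing_ideal_zariski_closure[OF aspace] vanishing_ideal_real_image)
  then show False
    using indep P(1,2) by (simp add: algebraically_independent_on_def vanishing_ideal_def)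
qed

section \<open>The term order\<close>

lemma lex_less_irrefl: "\<not> lex_less m m"
  by (simp add: lex_less_def)

lemma lex_less_trans:
  assumes "lex_less a b" "lex_less b c"
  shows "lex_less a c"
proof -
  obtain i where i: "lookup a i < lookup b i" "\<forall>k>i. lookup a k = lookup b k"
    using assms(1) by (auto simp: lex_less_def)
  obtain j where j: "lookup b j < lookup c j" "\<forall>k>j. lookup b k = lookup c k"
    using assms(2) by (auto simp: lex_less_def)
  have "lookup a (max i j) < lookup c (max i j)"
    using i j by (cases i j rule: linorder_cases) (auto simp: max_def)
  moreover have "\<forall>k>max i j. lookup a k = lookup c k"
    using i j by auto
  ultimately show ?thesis by (auto simp: lex_less_def)
qed

lemma lex_less_total:
  assumes "a \<noteq> b"
  shows "lex_less a b \<or> lex_less b a"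
proof -
  let ?D = "{k. lookup a k \<noteq> lookup b k}"
  have fin: "finite ?D"
    by (rule finite_subset[of _ "keys a \<union> keys b"]) (auto simp: in_keys_iff)
  have "?D \<noteq> {}" using assms by (auto intro: poly_mapping_eqI)
  define M where "M = Max ?D"
  have "lookup a M \<noteq> lookup b M" using Max_in[OF fin \<open>?D \<noteq> {}\<close>] by (simp add: M_def)
  moreover have "\<forall>k>M. lookup a k = lookup b k"
    using Max_ge[OF fin] unfolding M_def by (meson leD mem_Collect_eq)
  ultimately have "lookup a M < lookup b M \<and> (\<forall>k>M. lookup a k = lookup b k) \<or>
      lookup b M < lookup a M \<and> (\<forall>k>M. lookup b k = lookup a k)"
    by (simp add: neq_iff)
  then show ?thesis unfolding lex_less_def by blast
qed

lemma lex_less_add: "lex_less a b \<Longrightarrow> lex_less (c + a) (c + b)"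
  by (auto simp: lex_less_def lookup_add)

lemma term_less_irrefl: "\<not> term_less m m"
  by (simp add: term_less_def lex_less_irrefl)

lemma term_less_trans: "term_less a b \<Longrightarrow> term_less b c \<Longrightarrow> term_less a c"
  by (auto simp: term_less_def intro: lex_less_trans)

lemma term_less_total: "a \<noteq> b \<Longrightarrow> term_less a b \<or> term_less b a"
  using lex_less_total by (auto simp: term_less_def)

lemma term_less_add: "term_less a b \<Longrightarrow> term_less (c + a) (c + b)"
  by (auto simp: term_less_def mweight_eq_wdeg wdeg_add lex_less_add)

abbreviation term_le :: "monom \<Rightarrow> monom \<Rightarrow> bool" where
  "term_le m n \<equiv> m = n \<or> term_less m n"

lemma term_le_less_add:
  assumes "term_le a m" "term_less b n"
  shows "term_less (a + b) (m + n)"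
proof -
  have "term_le (a + n) (m + n)"
    using assms(1) term_less_add[of a m n] by (auto simp: add.commute)
  moreover have "term_less (a + b) (a + n)" by (rule term_less_add[OF assms(2)])
  ultimately show ?thesis using term_less_trans by metis
qed

lemma term_less_greatest:
  assumes "finite A" "A \<noteq> {}"
  obtains m where "m \<in> A" "\<And>n. n \<in> A \<Longrightarrow> term_le n m"
proof -
  have "transp_on A term_less" by (rule transp_onI) (rule term_less_trans)
  moreover have "totalp_on A term_less" by (rule totalp_onI) (rule term_less_total)
  ultimately show thesis
    using Finite_Set.bex_greatest_element[OF assms] that by blast
qed

lemma lead_monom_eqI:
  assumes "m \<in> keys p" "\<And>n. n \<in> keys p \<Longrightarrow> term_le n m"
  shows "lead_monom p = m"
  unfolding lead_monom_def
proof (rule the_equality)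
  show "m \<in> keys p \<and> (\<forall>n\<in>keys p. n \<noteq> m \<longrightarrow> term_less n m)" using assms by blast
  show "n = m" if "n \<in> keys p \<and> (\<forall>m'\<in>keys p. m' \<noteq> n \<longrightarrow> term_less m' n)" for n
    using assms that term_less_trans term_less_irrefl by metis
qed

lemma lead_monom_greatest:
  assumes "p \<noteq> 0"
  shows "lead_monom p \<in> keys p" "n \<in> keys p \<Longrightarrow> term_le n (lead_monom p)"
proof -
  obtain m where m: "m \<in> keys p" "\<And>n. n \<in> keys p \<Longrightarrow> term_le n m"
    using term_less_greatest[of "keys p"] assms by (metis finite_keys keys_eq_empty)
  then have "lead_monom p = m" by (rule lead_monom_eqI)
  with m show "lead_monom p \<in> keys p" "n \<in> keys p \<Longrightarrow> term_le n (lead_monom p)" by auto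
qed

lemma lead_monom_single_add:
  assumes "c \<noteq> 0" "\<And>n. n \<in> keys r \<Longrightarrow> term_less n m"
  shows "single m c + r \<noteq> 0" "lead_monom (single m c + r) = m"
proof -
  have "lookup r m = 0"
    using assms(2)[of m] term_less_irrefl by (auto simp: in_keys_iff)
  then have m: "m \<in> keys (single m c + r)"
    using assms(1) by (simp add: in_keys_iff lookup_add)
  then show "single m c + r \<noteq> 0" by auto
  show "lead_monom (single m c + r) = m"
    using m keys_add[of "single m c" r] assms by (intro lead_monom_eqI) (auto split: if_splits)
qed

lemma lead_monom_decomposition:
  assumes "p \<noteq> 0"
  obtains c r where "c \<noteq> 0" "p = single (lead_monom p) c + r"
    "\<forall>n\<in>keys r. n \<in> keys p \<and> term_less n (lead_monom p)"
proof
  let ?c = "lookup p (lead_monom p)"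
  let ?r = "p - single (lead_monom p) ?c"
  show "?c \<noteq> 0" using lead_monom_greatest(1)[OF assms] by (simp add: in_keys_iff)
  show "p = single (lead_monom p) ?c + ?r" by simp
  show "\<forall>n\<in>keys ?r. n \<in> keys p \<and> term_less n (lead_monom p)"
  proof
    fix n assume "n \<in> keys ?r"
    then have "n \<in> keys p" "n \<noteq> lead_monom p"
      by (auto simp: in_keys_iff lookup_minus lookup_single when_def split: if_splits)
    then show "n \<in> keys p \<and> term_less n (lead_monom p)"
      using lead_monom_greatest(2)[OF assms] by blast
  qed
qed

lemma term_less_keys_mult:
  assumes "\<forall>a\<in>keys p. term_le a m" "\<forall>b\<in>keys q. term_less b n" "k \<in> keys (p * q)"
  shows "term_less k (m + n)"
proof -
  obtain a b where "k = a + b" "a \<in> keys p" "b \<in> keys q"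
    using keys_mult[of p q] assms(3) by blast
  then show ?thesis using assms(1,2) term_le_less_add by simp
qed

lemma lead_monom_mult:
  assumes "p \<noteq> 0" "q \<noteq> 0"
  shows "lead_monom (p * q) = lead_monom p + lead_monom q"
proof -
  define m n where "m = lead_monom p" and "n = lead_monom q"
  obtain a r where r: "a \<noteq> 0" "p = single m a + r" "\<forall>k\<in>keys r. k \<in> keys p \<and> term_less k m"
    by (rule lead_monom_decomposition[OF assms(1), folded m_def])
  obtain b s where s: "b \<noteq> 0" "q = single n b + s" "\<forall>k\<in>keys s. k \<in> keys q \<and> term_less k n"
    by (rule lead_monom_decomposition[OF assms(2), folded n_def])
  have "p * q = single m a * q + q * r"
    by (subst r(2)) (simp add: algebra_simps)
  also have "single m a * q = single (m + n) (a * b) + single m a * s"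
    by (subst s(2)) (simp add: distrib_left mult_single)
  finally have "p * q = single (m + n) (a * b) + (single m a * s + q * r)"
    by (simp add: add.assoc)
  moreover have "a * b \<noteq> 0" using r(1) s(1) by simp
  moreover have "term_less k (m + n)" if "k \<in> keys (single m a * s + q * r)" for k
  proof -
    have "k \<in> keys (single m a * s) \<or> k \<in> keys (q * r)"
      using that keys_add[of "single m a * s" "q * r"] by blast
    then show ?thesis
    proof
      assume "k \<in> keys (single m a * s)"
      then show ?thesis by (rule term_less_keys_mult[rotated 2]) (use s(3) in auto)
    next
      assume "k \<in> keys (q * r)"
      then have "term_less k (n + m)"
        by (rule term_less_keys_mult[rotated 2])
          (use r(3) lead_monom_greatest(2)[OF assms(2)] in \<open>auto simp: n_def\<close>)
      then show ?thesis by (simp add: add.commute)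
    qed
  qed
  ultimately show ?thesis
    by (simp add: lead_monom_single_add(2) flip: m_def n_def)
qed

lemma lead_monom_one: "lead_monom 1 = 0"
  by (rule lead_monom_eqI) auto

lemma lookup_lead_monom_power:
  "p \<noteq> 0 \<Longrightarrow> lookup (lead_monom (p ^ k)) j = k * lookup (lead_monom p) j"
  by (induction k) (simp_all add: lead_monom_one lead_monom_mult lookup_add)

lemma lookup_lead_monom_prod:
  assumes "finite A" "\<And>i. i \<in> A \<Longrightarrow> f i \<noteq> 0"
  shows "lookup (lead_monom (prod f A)) j = (\<Sum>i\<in>A. lookup (lead_monom (f i)) j)"
  using assms
proof (induction A rule: finite_induct)
  case (insert i A)
  then have "lead_monom (prod f (insert i A)) = lead_monom (f i) + lead_monom (prod f A)"
    by (simp add: lead_monom_mult)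
  then show ?case using insert by (simp add: lookup_add)
qed (simp add: lead_monom_one)

lemma lookup_lead_monom_monom_prod:
  assumes "\<And>i. i \<in> keys m \<Longrightarrow> f i \<noteq> 0"
  shows "lookup (lead_monom (monom_prod f m)) j = wdeg (\<lambda>i. lookup (lead_monom (f i)) j) m"
  using assms unfolding monom_prod_def wdeg_def
  by (simp add: lookup_lead_monom_prod lookup_lead_monom_power mult.commute)

lemma mpoly_compose_nonzero_if_distinct_lead_monoms:
  assumes "p \<noteq> 0" and nonzero: "\<And>m. m \<in> keys p \<Longrightarrow> monom_prod f m \<noteq> 0"
    and inj: "inj_on (\<lambda>m. lead_monom (monom_prod f m)) (keys p)"
  shows "mpoly_compose f p \<noteq> 0"
proof -
  let ?L = "\<lambda>m. lead_monom (monom_prod f m)"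
  have "finite (?L ` keys p)" "?L ` keys p \<noteq> {}" using \<open>p \<noteq> 0\<close> by simp_all
  then obtain k where "k \<in> ?L ` keys p" and k: "\<And>n. n \<in> ?L ` keys p \<Longrightarrow> term_le n k"
    by (rule term_less_greatest) blast
  then obtain m where m: "m \<in> keys p" "k = ?L m" by blast
  then have max: "term_le (?L n) (?L m)" if "n \<in> keys p" for n
    using k that by blast
  have "lookup (monom_prod f n) (?L m) = 0" if n: "n \<in> keys p" "n \<noteq> m" for n
  proof -
    have "term_less (?L n) (?L m)" using inj m(1) max[OF n(1)] n by (auto simp: inj_on_def)
    then have "?L m \<notin> keys (monom_prod f n)"
      using lead_monom_greatest(2)[OF nonzero[OF n(1)]] term_less_irrefl term_less_trans by metis
    then show ?thesis by (simp add: in_keys_iff)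
  qed
  then have "lookup (mpoly_compose f p) (?L m) =
      (\<Sum>n\<in>{m}. lookup p n * lookup (monom_prod f n) (?L m))"
    unfolding mpoly_compose.subst_def lookup_sum lookup_const_mult
    using m(1) by (intro sum.mono_neutral_right) auto
  also have "\<dots> \<noteq> 0"
    using m(1) lead_monom_greatest(1)[OF nonzero[OF m(1)]] by (simp add: in_keys_iff)
  finally show ?thesis by auto
qed

section \<open>Normal forms modulo an ideal\<close>

definition has_normal_form :: "mpoly set \<Rightarrow> monom set \<Rightarrow> monom \<Rightarrow> bool" where
  "has_normal_form J S m \<longleftrightarrow>
     (\<exists>N. single m 1 - N \<in> J \<and> keys N \<subseteq> S \<and> (\<forall>n\<in>keys N. term_le n m))"

lemma normal_form_exists:
  assumes J: "is_ideal_in (polyring d) J" and nf: "\<And>m. m \<in> keys p \<Longrightarrow> has_normal_form J S m"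
  obtains N where "p - N \<in> J" "keys N \<subseteq> S" "\<forall>n\<in>keys N. \<exists>m\<in>keys p. term_le n m"
proof -
  obtain R where R: "\<And>m. m \<in> keys p \<Longrightarrow>
      single m 1 - R m \<in> J \<and> keys (R m) \<subseteq> S \<and> (\<forall>n\<in>keys (R m). term_le n m)"
    using nf unfolding has_normal_form_def by metis
  define N where "N = (\<Sum>m\<in>keys p. single 0 (lookup p m) * R m)"
  have "(\<Sum>m\<in>keys p. single 0 (lookup p m) * (single m 1 - R m)) \<in> J"
    using J R by (intro ideal_sum[OF J]) (simp add: is_ideal_in_def polyring_eq polys_in_const)
  moreover have "(\<Sum>m\<in>keys p. single 0 (lookup p m) * (single m 1 - R m)) = p - N"
    by (simp add: N_def right_diff_distrib mult_single sum_subtractf sum_single_lookup)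
  ultimately have "p - N \<in> J" by simp
  moreover have keys_N: "\<exists>m\<in>keys p. n \<in> keys (R m)" if n: "n \<in> keys N" for n
  proof -
    obtain m where "m \<in> keys p" "n \<in> keys (single 0 (lookup p m) * R m)"
      using subsetD[OF keys_sum n[unfolded N_def]] by blast
    then show ?thesis by (auto simp: in_keys_iff lookup_const_mult)
  qed
  moreover have "keys N \<subseteq> S" using keys_N R by blast
  moreover have "\<forall>n\<in>keys N. \<exists>m\<in>keys p. term_le n m"
    using keys_N R by blast
  ultimately show thesis by (intro that)
qed

lemma has_normal_form_standard: "is_ideal_in (polyring d) J \<Longrightarrow> m \<in> S \<Longrightarrow> has_normal_form J S m"
  unfolding has_normal_form_def by (rule exI[of _ "single m 1"]) (simp add: is_ideal_in_def)

lemma has_normal_form_step: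
  assumes J: "is_ideal_in (polyring d) J" and "single m 1 - p \<in> J"
    and p: "\<And>n. n \<in> keys p \<Longrightarrow> term_less n m \<and> has_normal_form J S n"
  shows "has_normal_form J S m"
proof -
  have "has_normal_form J S n" if "n \<in> keys p" for n
    using p[OF that] ..
  then obtain N where N: "p - N \<in> J" "keys N \<subseteq> S"
    "\<forall>n\<in>keys N. \<exists>m\<in>keys p. term_le n m"
    by (rule normal_form_exists[OF J])
  have "(single m 1 - p) + (p - N) \<in> J"
    using J N(1) assms(2) unfolding is_ideal_in_def by blast
  then have "single m 1 - N \<in> J" by simp
  moreover have "\<forall>n\<in>keys N. term_le n m"
    using N(3) p term_less_trans by metis
  ultimately show ?thesis using N(2) unfolding has_normal_form_def by blast
qed

lemma ideal_eqI_normal_forms: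
  assumes J: "is_ideal_in (polyring d) J" and K: "is_ideal_in (polyring d) K" and "J \<subseteq> K"
    and nf: "\<And>m. keys m \<subseteq> {..d} \<Longrightarrow> has_normal_form J S m"
    and zero: "\<And>N. N \<in> K \<Longrightarrow> keys N \<subseteq> S \<Longrightarrow> N = 0"
  shows "J = K"
proof
  show "K \<subseteq> J"
  proof
    fix p assume p: "p \<in> K"
    then have "p \<in> polyring d" using K by (auto simp: is_ideal_in_def)
    then have "has_normal_form J S m" if "m \<in> keys p" for m
      using that nf by (auto simp: polyring_eq polys_in_def)
    then obtain N where N: "p - N \<in> J" "keys N \<subseteq> S"
      by (rule normal_form_exists[OF J])
    then have "p - (p - N) \<in> K" using ideal_diff[OF K p] \<open>J \<subseteq> K\<close> by blast
    then have "N = 0" using zero N(2) by simp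
    then show "p \<in> J" using N(1) by simp
  qed
qed fact

lemma lead_monom_notin_standard:
  assumes J: "is_ideal_in (polyring d) J"
    and nf: "\<And>m. keys m \<subseteq> {..d} \<Longrightarrow> has_normal_form J S m"
    and zero: "\<And>N. N \<in> J \<Longrightarrow> keys N \<subseteq> S \<Longrightarrow> N = 0"
    and p: "p \<in> J" "p \<noteq> 0"
  shows "lead_monom p \<notin> S"
proof
  assume std: "lead_monom p \<in> S"
  define m where "m = lead_monom p"
  obtain c r where r: "c \<noteq> 0" "p = single m c + r" "\<forall>n\<in>keys r. n \<in> keys p \<and> term_less n m"
    by (rule lead_monom_decomposition[OF p(2), folded m_def])
  have "p \<in> polyring d" using J p(1) by (auto simp: is_ideal_in_def)
  then have "has_normal_form J S m" if "m \<in> keys r" for m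
    using that r(3) nf by (auto simp: polyring_eq polys_in_def)
  then obtain N where N: "r - N \<in> J" "keys N \<subseteq> S"
    "\<forall>n\<in>keys N. \<exists>m\<in>keys r. term_le n m"
    by (rule normal_form_exists[OF J])
  have "p - (r - N) \<in> J" by (rule ideal_diff[OF J p(1) N(1)])
  then have "single m c + N \<in> J" by (simp add: r(2))
  moreover have "keys (single m c + N) \<subseteq> S"
    using keys_add[of "single m c" N] std N(2) by (auto simp: m_def split: if_splits)
  ultimately have "single m c + N = 0" by (rule zero)
  moreover have "term_less n m" if "n \<in> keys N" for n
    using N(3) that r(3) term_less_trans by metis
  ultimately show False using lead_monom_single_add(1)[OF r(1)] by blast
qed

section \<open>The generators and the standard monomials\<close>

definition quad :: "nat \<Rightarrow> nat \<Rightarrow> monom" where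
  "quad i j = single i 1 + single j 1"

lemma Var_mult_Var: "Var i * Var j = single (quad i j) 1"
  by (simp add: Var_def quad_def mult_single)

lemma lookup_quad: "lookup (quad i j) k = (if k = i then 1 else 0) + (if k = j then 1 else 0)"
  by (simp add: quad_def lookup_add lookup_single when_def)

lemma wdeg_quad: "wdeg w (quad i j) = w i + w j"
  by (simp add: quad_def wdeg_add)

lemma keys_quad: "keys (quad i j) = {i, j}"
  by (auto simp: in_keys_iff lookup_quad split: if_splits)

lemma monom_dvd_imp_add: "monom_dvd a m \<Longrightarrow> \<exists>m'. m = m' + a"
  by (rule exI[of _ "m - a"], rule poly_mapping_eqI)
    (simp add: monom_dvd_def lookup_add lookup_minus)

lemma quad_dvd:
  assumes "i \<in> keys m" "j \<in> keys m" "i \<noteq> j"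
  shows "monom_dvd (quad i j) m"
  using assms by (auto simp: monom_dvd_def lookup_quad in_keys_iff)

definition gen_tail :: "nat \<Rightarrow> nat \<Rightarrow> mpoly" where
  "gen_tail i j = Var (i + 1) * Var (j - 1) - Var (i - 1) * Var (j - 1) + Var i * Var (j - 2)"

definition gen :: "nat \<Rightarrow> nat \<Rightarrow> mpoly" where
  "gen i j = Var i * Var j - gen_tail i j"

lemma gens_eq: "gens d = {gen i j | i j. 1 \<le> i \<and> i < d \<and> 2 \<le> j \<and> j \<le> d}"
proof (intro equalityI subsetI)
  fix g assume "g \<in> gens d"
  then obtain y v where yv: "g = f_yv y v" "fst y + snd y = d - 1" "fst v + snd v = d - 1"
    "snd y \<ge> 1" "fst v \<ge> 1"
    by (auto simp: gens_def)
  then have "g = gen (fst y + 1) (fst v + 1)"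
    by (simp add: gen_def gen_tail_def f_yv_def u_def numeral_2_eq_2)
  moreover have "1 \<le> fst y + 1" "fst y + 1 < d" "2 \<le> fst v + 1" "fst v + 1 \<le> d"
    using yv by auto
  ultimately show "g \<in> {gen i j | i j. 1 \<le> i \<and> i < d \<and> 2 \<le> j \<and> j \<le> d}" by blast
next
  fix g assume "g \<in> {gen i j | i j. 1 \<le> i \<and> i < d \<and> 2 \<le> j \<and> j \<le> d}"
  then obtain i j where ij: "g = gen i j" "1 \<le> i" "i < d" "2 \<le> j" "j \<le> d" by blast
  then obtain k l where ij_Suc: "i = Suc k" "j = Suc (Suc l)"
    by (metis One_nat_def Suc_le_D numeral_2_eq_2 Suc_le_mono)
  have "g = f_yv (k, d - i) (Suc l, d - j)"
    unfolding ij(1) gen_def gen_tail_def f_yv_def u_def by (simp add: ij_Suc)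
  then show "g \<in> gens d"
    unfolding gens_def using ij ij_Suc
    by (intro CollectI exI[of _ "(k, d - i)"] exI[of _ "(Suc l, d - j)"]) auto
qed

lemma gens_subset_polyring: "gens d \<subseteq> polyring d"
  unfolding gens_eq gen_def gen_tail_def polyring_eq by (auto intro!: polys_in_intros)

lemma gen_in_ideal_gens: "1 \<le> i \<Longrightarrow> i + 2 \<le> j \<Longrightarrow> j \<le> d \<Longrightarrow> gen i j \<in> ideal_gen d (gens d)"
  using ideal_gen_base[of "gens d" d] unfolding gens_eq by fastforce

text \<open>The weight \<open>\<Sum>i\<^sup>2 m\<^sub>i\<close> is a termination measure for the reduction modulo the generators,
  because \<open>i\<^sup>2\<close> is strictly convex and increasing in \<open>i\<close>.\<close>

lemma keys_gen_tailD:
  assumes "n \<in> keys (gen_tail i j)" "1 \<le> i" "i + 2 \<le> j"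
  shows "keys n \<subseteq> {..j} \<and> wdeg (\<lambda>i. i\<^sup>2) n < wdeg (\<lambda>i. i\<^sup>2) (quad i j) \<and> term_less n (quad i j)"
proof -
  obtain k l where ij_Suc: "i = Suc k" "j = Suc (Suc l)" "k < l"
    using assms(2,3) by (intro that[of "i - 1" "j - 2"]) auto
  have "n \<in> {quad (i + 1) (j - 1), quad (i - 1) (j - 1), quad i (j - 2)}"
    using assms(1) unfolding gen_tail_def Var_mult_Var
    by (auto simp: in_keys_iff lookup_minus lookup_add lookup_single when_def split: if_splits)
  then consider (same_weight) "n = quad (Suc (Suc k)) (Suc l)"
    | (lower_weight) "n = quad k (Suc l) \<or> n = quad (Suc k) l"
    by (auto simp: ij_Suc)
  then show ?thesis
  proof cases
    case same_weight
    then have "lex_less n (quad i j)"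
      unfolding lex_less_def using ij_Suc by (intro exI[of _ j]) (auto simp: lookup_quad)
    then show ?thesis
      using same_weight ij_Suc
      by (auto simp: term_less_def mweight_eq_wdeg wdeg_quad keys_quad power2_eq_square)
  qed (use ij_Suc in
      \<open>auto simp: term_less_def mweight_eq_wdeg wdeg_quad keys_quad power2_eq_square\<close>)
qed

lemma lead_monom_gen:
  assumes "1 \<le> i" "i + 2 \<le> j"
  shows "gen i j \<noteq> 0" "lead_monom (gen i j) = quad i j"
  using lead_monom_single_add[of 1 "- gen_tail i j" "quad i j"] keys_gen_tailD assms
  by (auto simp: gen_def Var_mult_Var)

definition standard_monoms :: "nat \<Rightarrow> monom set" where
  "standard_monoms d = {m. keys m \<subseteq> {..d} \<and> (\<forall>i\<in>keys m. \<forall>j\<in>keys m. 1 \<le> i \<longrightarrow> j < i + 2)}"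

lemma nonstandard_monomE:
  assumes "keys m \<subseteq> {..d}" "m \<notin> standard_monoms d"
  obtains i j where "1 \<le> i" "i + 2 \<le> j" "j \<le> d" "monom_dvd (quad i j) m"
proof -
  obtain i j where ij: "i \<in> keys m" "j \<in> keys m" "1 \<le> i" "i + 2 \<le> j"
    using assms by (auto simp: standard_monoms_def not_less)
  moreover have "j \<le> d" "i \<noteq> j" using assms(1) ij by auto
  ultimately show thesis using quad_dvd by (intro that)
qed

lemma nonstandard_monom_reducible:
  assumes "keys m \<subseteq> {..d}" "m \<notin> standard_monoms d"
  obtains p where "single m 1 - p \<in> ideal_gen d (gens d)"
    "\<forall>n\<in>keys p. keys n \<subseteq> {..d} \<and> wdeg (\<lambda>i. i\<^sup>2) n < wdeg (\<lambda>i. i\<^sup>2) m \<and> term_less n m"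
proof -
  obtain i j where ij: "1 \<le> i" "i + 2 \<le> j" "j \<le> d" and "monom_dvd (quad i j) m"
    using nonstandard_monomE[OF assms] by blast
  then obtain m' where m: "m = m' + quad i j" using monom_dvd_imp_add by blast
  have keys_m': "keys m' \<subseteq> {..d}"
    using assms(1) by (auto simp: m in_keys_iff lookup_add subset_iff)
  have "single m' 1 * gen i j \<in> ideal_gen d (gens d)"
    using is_ideal_ideal_gen[OF gens_subset_polyring] gen_in_ideal_gens[OF ij]
      polys_in_single[OF keys_m']
    by (simp add: is_ideal_in_def polyring_eq)
  then have "single m 1 - single m' 1 * gen_tail i j \<in> ideal_gen d (gens d)"
    by (simp add: gen_def m Var_mult_Var right_diff_distrib mult_single)
  moreover have "keys n \<subseteq> {..d} \<and> wdeg (\<lambda>i. i\<^sup>2) n < wdeg (\<lambda>i. i\<^sup>2) m \<and> term_less n m"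
    if n: "n \<in> keys (single m' 1 * gen_tail i j)" for n
  proof -
    obtain n' where n': "n = m' + n'" "n' \<in> keys (gen_tail i j)"
      using n keys_mult[of "single m' 1" "gen_tail i j"] by auto
    note smaller = keys_gen_tailD[OF n'(2) ij(1,2)]
    then have "keys n \<subseteq> {..d}"
      using ij(3) keys_m' keys_add[of m' n'] unfolding n'(1) by fastforce
    then show ?thesis using smaller by (simp add: n'(1) m wdeg_add term_less_add)
  qed
  ultimately show thesis by (intro that) blast+
qed

lemma has_normal_form_modulo_gens:
  assumes "keys m \<subseteq> {..d}"
  shows "has_normal_form (ideal_gen d (gens d)) (standard_monoms d) m"
  using assms
proof (induction "wdeg (\<lambda>i. i\<^sup>2) m" arbitrary: m rule: less_induct)
  case less
  note ideal = is_ideal_ideal_gen[OF gens_subset_polyring, of d]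
  show ?case
  proof (cases "m \<in> standard_monoms d")
    case True
    then show ?thesis by (rule has_normal_form_standard[OF ideal])
  next
    case False
    then obtain p where "single m 1 - p \<in> ideal_gen d (gens d)"
      and "\<forall>n\<in>keys p. keys n \<subseteq> {..d} \<and> wdeg (\<lambda>i. i\<^sup>2) n < wdeg (\<lambda>i. i\<^sup>2) m \<and> term_less n m"
      by (rule nonstandard_monom_reducible[OF less.prems])
    then show ?thesis using less.hyps by (intro has_normal_form_step[OF ideal]) auto
  qed
qed

lemma wdeg_split_0: "wdeg w m = w 0 * lookup m 0 + (\<Sum>i\<in>keys m - {0}. w i * lookup m i)"
proof -
  have "wdeg w m = (\<Sum>i\<in>insert 0 (keys m). w i * lookup m i)"
    by (rule wdeg_superset) auto
  then show ?thesis by (simp add: sum.insert_remove)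
qed

definition degree_off_zero :: "monom \<Rightarrow> nat" where
  "degree_off_zero m = wdeg (\<lambda>i. if i = 0 then 0 else 1) m"

lemma degree_off_zero_eq_0_iff: "degree_off_zero m = 0 \<longleftrightarrow> keys m \<subseteq> {0}"
  by (auto simp: degree_off_zero_def wdeg_def in_keys_iff split: if_splits)

lemma standard_monom_support:
  assumes "m \<in> standard_monoms d" "degree_off_zero m \<noteq> 0"
  obtains i where "i \<noteq> 0" "0 < lookup m i" "keys m \<subseteq> {0, i, Suc i}"
proof -
  let ?S = "keys m - {0}"
  have "?S \<noteq> {}" using assms(2) by (auto simp: degree_off_zero_eq_0_iff)
  define i where "i = Min ?S"
  have i: "i \<in> keys m" "i \<noteq> 0" using Min_in[of ?S] \<open>?S \<noteq> {}\<close> unfolding i_def by auto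
  have "k \<in> {0, i, Suc i}" if "k \<in> keys m" for k
  proof (cases "k = 0")
    case False
    then have "i \<le> k" unfolding i_def using that by (intro Min_le) auto
    moreover have "k < i + 2" using assms(1) i that by (auto simp: standard_monoms_def)
    ultimately show ?thesis by auto
  qed simp
  then show thesis using i by (intro that[of i]) (auto simp: in_keys_iff)
qed

text \<open>For \<open>m = u\<^sub>0\<^sup>k u\<^sub>i\<^sup>p u\<^bsub>i+1\<^esub>\<^sup>q\<close> with \<open>p > 0\<close> the weight is \<open>i (p + q) + q\<close> and \<open>q < p + q\<close>, so
  \<open>i\<close> and \<open>q\<close> are quotient and remainder of the weight by \<open>p + q\<close>.\<close>

lemma lookup_standard_monom:
  assumes "m \<in> standard_monoms d" "degree_off_zero m \<noteq> 0" "k \<noteq> 0"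
  defines "c \<equiv> degree_off_zero m" and "i \<equiv> mweight m div degree_off_zero m"
  shows "lookup m k =
    (if k = i then c - mweight m mod c else if k = Suc i then mweight m mod c else 0)"
proof -
  obtain j where j: "j \<noteq> 0" "0 < lookup m j" "keys m \<subseteq> {0, j, Suc j}"
    using standard_monom_support assms(1,2) by blast
  have wdeg: "wdeg w m = w 0 * lookup m 0 + w j * lookup m j + w (Suc j) * lookup m (Suc j)" for w
    using j by (simp add: wdeg_superset[of "{0, j, Suc j}"])
  have c_eq: "c = lookup m j + lookup m (Suc j)"
    using j(1) by (simp add: c_def degree_off_zero_def wdeg)
  then have weight: "mweight m = lookup m (Suc j) + j * c"
    by (simp add: mweight_eq_wdeg wdeg algebra_simps)
  have "lookup m (Suc j) < c" using c_eq j(2) by simp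
  then have "i = j" "mweight m mod c = lookup m (Suc j)"
    by (simp_all add: i_def weight flip: c_def)
  moreover have "lookup m k = 0" if "k \<noteq> j" "k \<noteq> Suc j"
    using that j(3) \<open>k \<noteq> 0\<close> by (auto simp: in_keys_iff)
  ultimately show ?thesis using c_eq by auto
qed

lemma standard_monom_eqI:
  assumes "m \<in> standard_monoms d" "n \<in> standard_monoms d"
    and "lookup m 0 = lookup n 0" "degree_off_zero m = degree_off_zero n" "mweight m = mweight n"
  shows "m = n"
proof (rule poly_mapping_eqI)
  fix k :: nat
  show "lookup m k = lookup n k"
  proof (cases "k = 0 \<or> degree_off_zero m \<noteq> 0")
    case True
    then show ?thesis
      using assms lookup_standard_monom[of m d k] lookup_standard_monom[of n d k]
      by (cases "k = 0") simp_all
  next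
    case False
    then have "k \<notin> keys m" "k \<notin> keys n"
      using assms(4) degree_off_zero_eq_0_iff[of m] degree_off_zero_eq_0_iff[of n] by auto
    then show ?thesis by (simp add: in_keys_iff)
  qed
qed

section \<open>A parametrization of odeco tensors\<close>

definition odeco_coords :: "nat \<Rightarrow> 'a \<Rightarrow> 'a \<Rightarrow> 'a \<Rightarrow> nat \<Rightarrow> 'a::comm_ring_1" where
  "odeco_coords d a b t i = (if i \<le> d then a * t ^ i + b * (- 1) ^ i * t ^ (d - i) else 0)"

lemma odeco_coords_of_real:
  fixes a b t :: real
  shows "odeco_coords d (of_real a) (of_real b) (of_real t) =
    (\<lambda>i. if i \<le> d then complex_of_real (a * t ^ i + b * (- 1) ^ i * t ^ (d - i)) else 0)"
  by (simp add: odeco_coords_def fun_eq_iff)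

lemma odeco_coords_real_in_odeco_tensors:
  fixes a b t :: real
  shows "odeco_coords d (of_real a) (of_real b) (of_real t) \<in> odeco_tensors d"
proof -
  define r where "r = sqrt (1 + t\<^sup>2)"
  have r_squared_pos: "0 < 1 + t\<^sup>2" by (simp add: add_pos_nonneg)
  then have r: "r\<^sup>2 = 1 + t\<^sup>2" "r \<noteq> 0" by (simp_all add: r_def)
  define p\<^sub>1 q\<^sub>1 where "p\<^sub>1 = t / r" and "q\<^sub>1 = 1 / r"
  define l\<^sub>1 l\<^sub>2 where "l\<^sub>1 = a * r ^ d / fact d" and "l\<^sub>2 = b * r ^ d / fact d"
  have "t\<^sup>2 / r\<^sup>2 + 1 / r\<^sup>2 = 1"
    using r_squared_pos by (simp add: r(1) add.commute flip: add_divide_distrib)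
  then have orthonormal: "p\<^sub>1\<^sup>2 + q\<^sub>1\<^sup>2 = 1" "(- q\<^sub>1)\<^sup>2 + p\<^sub>1\<^sup>2 = 1" "p\<^sub>1 * (- q\<^sub>1) + q\<^sub>1 * p\<^sub>1 = 0"
    by (simp_all add: p\<^sub>1_def q\<^sub>1_def power_divide)
  have "a * t ^ i + b * (- 1) ^ i * t ^ (d - i) =
      fact d * (l\<^sub>1 * p\<^sub>1 ^ i * q\<^sub>1 ^ (d - i) + l\<^sub>2 * (- q\<^sub>1) ^ i * p\<^sub>1 ^ (d - i))" if "i \<le> d" for i
  proof -
    have r_power: "r ^ d = r ^ i * r ^ (d - i)" using that by (simp flip: power_add)
    show ?thesis
      unfolding l\<^sub>1_def l\<^sub>2_def p\<^sub>1_def q\<^sub>1_def r_power power_minus[of "1 / r"] power_divide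
      using r(2) by (simp add: field_simps)
  qed
  then have "odeco_coords d (of_real a) (of_real b) (of_real t) = (\<lambda>i. if i \<le> d then complex_of_real
      (fact d * (l\<^sub>1 * p\<^sub>1 ^ i * q\<^sub>1 ^ (d - i) + l\<^sub>2 * (- q\<^sub>1) ^ i * p\<^sub>1 ^ (d - i))) else 0)"
    unfolding odeco_coords_of_real by (simp add: fun_eq_iff del: of_real_add of_real_mult)
  with orthonormal show ?thesis unfolding odeco_tensors_def by blast
qed

lemma odeco_tensors_subset_aspace: "odeco_tensors d \<subseteq> aspace d"
  by (auto simp: odeco_tensors_def aspace_def)

lemma eval_gen_eq_0_if_proportional_rows:
  assumes rows: "\<And>k. 1 \<le> k \<Longrightarrow> k < d \<Longrightarrow> x k = \<alpha> * g k"
      "\<And>k. 1 \<le> k \<Longrightarrow> k < d \<Longrightarrow> x (k + 1) - x (k - 1) = \<beta> * g k"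
    and ij: "1 \<le> i" "i < d" "2 \<le> j" "j \<le> d"
  shows "eval_mpoly (gen i j) x = 0"
proof -
  have "eval_mpoly (gen i j) x =
      x i * (x (j - 1 + 1) - x (j - 1 - 1)) - x (j - 1) * (x (i + 1) - x (i - 1))"
    using ij by (simp add: gen_def gen_tail_def numeral_2_eq_2 algebra_simps)
  also have "\<dots> = (\<alpha> * g i) * (\<beta> * g (j - 1)) - (\<alpha> * g (j - 1)) * (\<beta> * g i)"
    using rows(1)[of i] rows(1)[of "j - 1"] rows(2)[of i] rows(2)[of "j - 1"] ij by simp
  finally show ?thesis by simp
qed

lemma orthonormal_rows_proportional:
  fixes l\<^sub>1 l\<^sub>2 p\<^sub>1 q\<^sub>1 p\<^sub>2 q\<^sub>2 :: real
  assumes orthonormal: "p\<^sub>1\<^sup>2 + q\<^sub>1\<^sup>2 = 1" "p\<^sub>2\<^sup>2 + q\<^sub>2\<^sup>2 = 1" "p\<^sub>1 * p\<^sub>2 + q\<^sub>1 * q\<^sub>2 = 0"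
    and "1 \<le> k" "k < d"
  defines "y \<equiv> \<lambda>i. l\<^sub>1 * p\<^sub>1 ^ i * q\<^sub>1 ^ (d - i) + l\<^sub>2 * p\<^sub>2 ^ i * q\<^sub>2 ^ (d - i)"
    and "g \<equiv> \<lambda>i. l\<^sub>1 * p\<^sub>1 ^ (i - 1) * q\<^sub>1 ^ (d - i - 1) - l\<^sub>2 * p\<^sub>2 ^ (i - 1) * q\<^sub>2 ^ (d - i - 1)"
  shows "y k = p\<^sub>1 * q\<^sub>1 * g k" "y (k + 1) - y (k - 1) = (p\<^sub>1\<^sup>2 - q\<^sub>1\<^sup>2) * g k"
proof -
  obtain l where k_Suc: "k = Suc l" using \<open>1 \<le> k\<close> by (cases k) auto
  obtain e where d_eq: "d = Suc (Suc (l + e))" using \<open>k < d\<close> k_Suc less_iff_Suc_add by auto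
  define v\<^sub>1 v\<^sub>2 where "v\<^sub>1 = l\<^sub>1 * p\<^sub>1 ^ l * q\<^sub>1 ^ e" and "v\<^sub>2 = l\<^sub>2 * p\<^sub>2 ^ l * q\<^sub>2 ^ e"
  have opposite: "p\<^sub>2 * q\<^sub>2 = - (p\<^sub>1 * q\<^sub>1)" "p\<^sub>2\<^sup>2 - q\<^sub>2\<^sup>2 = - (p\<^sub>1\<^sup>2 - q\<^sub>1\<^sup>2)"
    using orthonormal by algebra+
  have g: "g k = v\<^sub>1 - v\<^sub>2" by (simp add: g_def v\<^sub>1_def v\<^sub>2_def k_Suc d_eq)
  have "y k = v\<^sub>1 * (p\<^sub>1 * q\<^sub>1) + v\<^sub>2 * (p\<^sub>2 * q\<^sub>2)"
    by (simp add: y_def v\<^sub>1_def v\<^sub>2_def k_Suc d_eq)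
  then show "y k = p\<^sub>1 * q\<^sub>1 * g k" unfolding opposite g by (simp add: algebra_simps)
  have "y (k + 1) - y (k - 1) = v\<^sub>1 * (p\<^sub>1\<^sup>2 - q\<^sub>1\<^sup>2) + v\<^sub>2 * (p\<^sub>2\<^sup>2 - q\<^sub>2\<^sup>2)"
    by (simp add: y_def v\<^sub>1_def v\<^sub>2_def k_Suc d_eq algebra_simps power2_eq_square)
  then show "y (k + 1) - y (k - 1) = (p\<^sub>1\<^sup>2 - q\<^sub>1\<^sup>2) * g k"
    unfolding opposite g by (simp add: algebra_simps)
qed

lemma odeco_tensor_rows_proportional:
  assumes "x \<in> odeco_tensors d"
  obtains \<alpha> \<beta> g where "\<And>k. 1 \<le> k \<Longrightarrow> k < d \<Longrightarrow> x k = \<alpha> * g k"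
    "\<And>k. 1 \<le> k \<Longrightarrow> k < d \<Longrightarrow> x (k + 1) - x (k - 1) = \<beta> * g k"
proof -
  obtain l\<^sub>1 l\<^sub>2 p\<^sub>1 q\<^sub>1 p\<^sub>2 q\<^sub>2 :: real where
    orthonormal: "p\<^sub>1\<^sup>2 + q\<^sub>1\<^sup>2 = 1" "p\<^sub>2\<^sup>2 + q\<^sub>2\<^sup>2 = 1" "p\<^sub>1 * p\<^sub>2 + q\<^sub>1 * q\<^sub>2 = 0"
    and x: "x = (\<lambda>i. if i \<le> d then complex_of_real (fact d *
            (l\<^sub>1 * p\<^sub>1 ^ i * q\<^sub>1 ^ (d - i) + l\<^sub>2 * p\<^sub>2 ^ i * q\<^sub>2 ^ (d - i))) else 0)"
    using assms unfolding odeco_tensors_def by blast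
  define y where "y i = l\<^sub>1 * p\<^sub>1 ^ i * q\<^sub>1 ^ (d - i) + l\<^sub>2 * p\<^sub>2 ^ i * q\<^sub>2 ^ (d - i)" for i
  define g where
    "g i = l\<^sub>1 * p\<^sub>1 ^ (i - 1) * q\<^sub>1 ^ (d - i - 1) - l\<^sub>2 * p\<^sub>2 ^ (i - 1) * q\<^sub>2 ^ (d - i - 1)" for i
  have x_y: "x i = of_real (fact d * y i)" if "i \<le> d" for i
    using that by (simp add: x y_def)
  have "x k = of_real (fact d * (p\<^sub>1 * q\<^sub>1)) * of_real (g k)" if "1 \<le> k" "k < d" for k
    using that orthonormal_rows_proportional(1)[OF orthonormal that] by (simp add: x_y y_def g_def)
  moreover have "x (k + 1) - x (k - 1) = of_real (fact d * (p\<^sub>1\<^sup>2 - q\<^sub>1\<^sup>2)) * of_real (g k)"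
    if "1 \<le> k" "k < d" for k
  proof -
    have "x (k + 1) - x (k - 1) = of_real (fact d * (y (k + 1) - y (k - 1)))"
      using that by (simp add: x_y right_diff_distrib)
    also have "y (k + 1) - y (k - 1) = (p\<^sub>1\<^sup>2 - q\<^sub>1\<^sup>2) * g k"
      unfolding y_def g_def by (rule orthonormal_rows_proportional(2)[OF orthonormal that])
    finally show ?thesis by simp
  qed
  ultimately show thesis by (rule that)
qed

lemma gens_vanish_on_odeco_tensors: "gens d \<subseteq> vanishing_ideal d (odeco_tensors d)"
proof
  fix f assume "f \<in> gens d"
  then obtain i j where f: "f = gen i j" "1 \<le> i" "i < d" "2 \<le> j" "j \<le> d"
    unfolding gens_eq by blast
  have "eval_mpoly f x = 0" if "x \<in> odeco_tensors d" for x
    using that by (rule odeco_tensor_rows_proportional)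
      (use f eval_gen_eq_0_if_proportional_rows[of d x] in blast)
  then show "f \<in> vanishing_ideal d (odeco_tensors d)"
    using \<open>f \<in> gens d\<close> gens_subset_polyring[of d] by (auto simp: vanishing_ideal_def)
qed

lemma eval_odeco_coords:
  "eval_mpoly (odeco_coords d a b t i) x =
    odeco_coords d (eval_mpoly a x) (eval_mpoly b x) (eval_mpoly t x) i"
  by (simp add: odeco_coords_def)

text \<open>The variables are numbered so that in the given term order \<open>u\<^sub>0\<close> has leading monomial
  \<open>b t\<^sup>d\<close> and \<open>u\<^sub>i\<close> has leading monomial \<open>a t\<^sup>i\<close> for \<open>i \<ge> 1\<close>: the weights of \<open>a, b, t\<close> are
  \<open>d + 1, 2, 1\<close>.\<close>

definition odeco_map :: "nat \<Rightarrow> nat set \<Rightarrow> nat \<Rightarrow> mpoly" where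
  "odeco_map d A =
    (let v = \<lambda>j. if j \<in> A then Var j else 0 in odeco_coords d (v (d + 1)) (v 2) (v 1))"

lemma real_image_odeco_map:
  "real_image (odeco_map d A) =
    {odeco_coords d (of_real (y (d + 1))) (of_real (y 2)) (of_real (y 1)) | y :: nat \<Rightarrow> real.
      \<forall>j. j \<notin> A \<longrightarrow> y j = 0}" (is "_ = {?F y | y. ?supp y}")
proof -
  have eval: "(\<lambda>i. eval_mpoly (odeco_map d A i) (\<lambda>j. of_real (y j))) =
      ?F (\<lambda>j. if j \<in> A then y j else 0)"
    for y :: "nat \<Rightarrow> real"
    by (auto simp: odeco_map_def Let_def eval_odeco_coords)
  have "?F y \<in> real_image (odeco_map d A)" if "?supp y" for y
  proof -
    have "?F y = ?F (\<lambda>j. if j \<in> A then y j else 0)" using that by simp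
    then show ?thesis unfolding real_image_def eval[symmetric] by blast
  qed
  moreover have "\<exists>y. ?supp y \<and> x = ?F y" if x: "x \<in> real_image (odeco_map d A)" for x
  proof -
    obtain y where "x = ?F (\<lambda>j. if j \<in> A then y j else 0)"
      using x unfolding real_image_def eval by blast
    then show ?thesis by (intro exI[of _ "\<lambda>j. if j \<in> A then y j else 0"]) simp
  qed
  ultimately show ?thesis by blast
qed

lemma real_image_odeco_map_mono: "A \<subseteq> B \<Longrightarrow> real_image (odeco_map d A) \<subseteq> real_image (odeco_map d B)"
  unfolding real_image_odeco_map by blast

lemma real_image_odeco_map_subset_odeco_tensors: "real_image (odeco_map d A) \<subseteq> odeco_tensors d"
  unfolding real_image_odeco_map using odeco_coords_real_in_odeco_tensors by blast

lemma real_image_odeco_map_subset_aspace: "real_image (odeco_map d A) \<subseteq> aspace d"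
  using real_image_odeco_map_subset_odeco_tensors odeco_tensors_subset_aspace by blast

lemma odeco_map_polys_in: "odeco_map d UNIV i \<in> polys_in {1, 2, d + 1}"
  by (auto simp: odeco_map_def odeco_coords_def intro!: polys_in_intros)

lemma odeco_map_eq_sum_monomials:
  assumes "i \<le> d"
  shows "odeco_map d UNIV i = single (single (d + 1) 1 + single 1 i) 1
    + single (single 2 1 + single 1 (d - i)) ((- 1) ^ i)"
proof -
  have "(- 1 :: mpoly) ^ i = single 0 ((- 1) ^ i)"
    by (cases "even i") (simp_all add: single_uminus)
  moreover have "odeco_map d UNIV i =
      Var (d + 1) ^ 1 * Var 1 ^ i + Var 2 ^ 1 * (- 1) ^ i * Var 1 ^ (d - i)"
    using assms by (simp add: odeco_map_def odeco_coords_def)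
  ultimately show ?thesis by (simp only: Var_power mult_single add_0_right mult_1_left mult_1_right)
qed

lemma lead_monom_odeco_map:
  assumes "i \<le> d"
  shows "odeco_map d UNIV i \<noteq> 0"
    and "lead_monom (odeco_map d UNIV i) =
      (if i = 0 then single 2 1 + single 1 d else single (d + 1) 1 + single 1 i)"
proof -
  let ?a = "single (d + 1) 1 + single 1 i :: monom"
  let ?b = "single 2 1 + single 1 (d - i) :: monom"
  have "odeco_map d UNIV i \<noteq> 0 \<and> lead_monom (odeco_map d UNIV i) = (if i = 0 then ?b else ?a)"
  proof (cases "i = 0")
    case True
    then have "term_less ?a ?b" by (simp add: term_less_def mweight_eq_wdeg wdeg_add)
    then show ?thesis
      using lead_monom_single_add[of "(- 1) ^ i" "single ?a 1" ?b] True
        odeco_map_eq_sum_monomials[OF assms] by (simp add: add.commute)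
  next
    case False
    then have "2 + (d - i) < d + 1 + i" using assms by linarith
    then have "term_less ?b ?a" by (simp add: term_less_def mweight_eq_wdeg wdeg_add)
    then show ?thesis
      using lead_monom_single_add[of 1 "single ?b ((- 1) ^ i)" ?a] False
        odeco_map_eq_sum_monomials[OF assms] by simp
  qed
  then show "odeco_map d UNIV i \<noteq> 0" "lead_monom (odeco_map d UNIV i) =
      (if i = 0 then single 2 1 + single 1 d else single (d + 1) 1 + single 1 i)"
    by auto
qed

lemma lookup_lead_monom_standard:
  assumes "d \<ge> 2" "m \<in> standard_monoms d"
  defines "L \<equiv> lead_monom (monom_prod (odeco_map d UNIV) m)"
  shows "lookup L 2 = lookup m 0" "lookup L (d + 1) = degree_off_zero m"
    and "lookup L 1 = d * lookup m 0 + mweight m"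
proof -
  have keys_m: "i \<le> d" if "i \<in> keys m" for i
    using that assms(2) by (auto simp: standard_monoms_def)
  have lookup_L: "lookup L j = wdeg w m"
    if "\<And>i. i \<le> d \<Longrightarrow> lookup (lead_monom (odeco_map d UNIV i)) j = w i" for j w
    unfolding L_def using keys_m lead_monom_odeco_map(1)
    by (subst lookup_lead_monom_monom_prod) (auto simp: that wdeg_def)
  have "lookup L 2 = wdeg (\<lambda>i. if i = 0 then 1 else 0) m"
    using assms(1)
    by (intro lookup_L) (auto simp: lead_monom_odeco_map lookup_add lookup_single when_def)
  then show "lookup L 2 = lookup m 0" by (simp add: wdeg_split_0)
  show "lookup L (d + 1) = degree_off_zero m"
    unfolding degree_off_zero_def using assms(1)
    by (intro lookup_L) (auto simp: lead_monom_odeco_map lookup_add lookup_single when_def)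
  have "lookup L 1 = wdeg (\<lambda>i. if i = 0 then d else i) m"
    using assms(1)
    by (intro lookup_L) (auto simp: lead_monom_odeco_map lookup_add lookup_single when_def)
  then show "lookup L 1 = d * lookup m 0 + mweight m"
    by (simp add: mweight_eq_wdeg wdeg_split_0)
qed

lemma standard_vanishing_on_odeco_eq_0:
  assumes "d \<ge> 2" "N \<in> vanishing_ideal d (real_image (odeco_map d UNIV))"
    and "keys N \<subseteq> standard_monoms d"
  shows "N = 0"
proof (rule ccontr)
  assume "N \<noteq> 0"
  then have "mpoly_compose (odeco_map d UNIV) N \<noteq> 0"
  proof (rule mpoly_compose_nonzero_if_distinct_lead_monoms)
    fix m assume "m \<in> keys N"
    then have "keys m \<subseteq> {..d}" using assms(3) by (auto simp: standard_monoms_def)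
    then show "monom_prod (odeco_map d UNIV) m \<noteq> 0"
      using lead_monom_odeco_map(1) by (auto simp: monom_prod_def)
  next
    show "inj_on (\<lambda>m. lead_monom (monom_prod (odeco_map d UNIV) m)) (keys N)"
    proof (rule inj_onI)
      fix m n
      assume "m \<in> keys N" "n \<in> keys N" and eq: "lead_monom (monom_prod (odeco_map d UNIV) m) =
        lead_monom (monom_prod (odeco_map d UNIV) n)"
      then have mn: "m \<in> standard_monoms d" "n \<in> standard_monoms d" using assms(3) by auto
      note lookup_lead = lookup_lead_monom_standard[OF assms(1)]
      have "lookup m 0 = lookup n 0" "degree_off_zero m = degree_off_zero n"
        using lookup_lead(1,2)[OF mn(1)] lookup_lead(1,2)[OF mn(2)] eq by simp_all
      moreover from this have "mweight m = mweight n"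
        using lookup_lead(3)[OF mn(1)] lookup_lead(3)[OF mn(2)] eq by simp
      ultimately show "m = n" by (rule standard_monom_eqI[OF mn])
    qed
  qed
  then show False using assms(2) by (simp add: vanishing_ideal_real_image)
qed

section \<open>The ideal of the odeco variety\<close>

lemma ideal_gens_eq_vanishing_ideal_odeco_map:
  assumes "d \<ge> 2"
  shows "ideal_gen d (gens d) = vanishing_ideal d (real_image (odeco_map d UNIV))"
proof (rule ideal_eqI_normal_forms)
  show "ideal_gen d (gens d) \<subseteq> vanishing_ideal d (real_image (odeco_map d UNIV))"
    using gens_vanish_on_odeco_tensors
      vanishing_ideal_antimono[OF real_image_odeco_map_subset_odeco_tensors]
    by (intro ideal_gen_least is_ideal_vanishing_ideal) blast
qed (use assms is_ideal_ideal_gen[OF gens_subset_polyring] is_ideal_vanishing_ideal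
    has_normal_form_modulo_gens standard_vanishing_on_odeco_eq_0 in blast)+

lemma ideal_gens_eq_vanishing_ideal_odeco_tensors:
  assumes "d \<ge> 2"
  shows "ideal_gen d (gens d) = vanishing_ideal d (odeco_tensors d)"
proof
  show "ideal_gen d (gens d) \<subseteq> vanishing_ideal d (odeco_tensors d)"
    by (rule ideal_gen_least[OF is_ideal_vanishing_ideal gens_vanish_on_odeco_tensors])
  show "vanishing_ideal d (odeco_tensors d) \<subseteq> ideal_gen d (gens d)"
    unfolding ideal_gens_eq_vanishing_ideal_odeco_map[OF assms]
    by (rule vanishing_ideal_antimono[OF real_image_odeco_map_subset_odeco_tensors])
qed

lemma ideal_gens_eq_vanishing_ideal_odeco_variety:
  "d \<ge> 2 \<Longrightarrow> ideal_gen d (gens d) = vanishing_ideal d (odeco_variety d)"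
  unfolding odeco_variety_def vanishing_ideal_zariski_closure[OF odeco_tensors_subset_aspace]
  by (rule ideal_gens_eq_vanishing_ideal_odeco_tensors)

lemma prime_ideal_gens: "d \<ge> 2 \<Longrightarrow> prime_ideal d (ideal_gen d (gens d))"
  unfolding ideal_gens_eq_vanishing_ideal_odeco_map
  by (rule prime_ideal_vanishing_ideal[OF irreducible_on_real_image])

lemma groebner_basis_gens:
  assumes "d \<ge> 2"
  shows "groebner_basis (gens d) (ideal_gen d (gens d))"
  unfolding groebner_basis_def
proof (intro conjI ballI impI)
  show "gens d \<subseteq> ideal_gen d (gens d)" by (rule ideal_gen_base)
  fix f assume f: "f \<in> ideal_gen d (gens d)" "f \<noteq> 0"
  note ideal = is_ideal_ideal_gen[OF gens_subset_polyring, of d]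
  have "lead_monom f \<notin> standard_monoms d"
    using lead_monom_notin_standard[OF ideal has_normal_form_modulo_gens _ f]
      standard_vanishing_on_odeco_eq_0[OF assms] ideal_gens_eq_vanishing_ideal_odeco_map[OF assms]
    by blast
  moreover have "f \<in> polyring d" using f(1) ideal by (auto simp: is_ideal_in_def)
  then have "keys (lead_monom f) \<subseteq> {..d}"
    using lead_monom_greatest(1)[OF f(2)] by (auto simp: polyring_eq polys_in_def)
  ultimately obtain i j where ij: "1 \<le> i" "i + 2 \<le> j" "j \<le> d" "monom_dvd (quad i j) (lead_monom f)"
    using nonstandard_monomE by blast
  then have "gen i j \<in> gens d" unfolding gens_eq by fastforce
  then show "\<exists>g\<in>gens d. g \<noteq> 0 \<and> monom_dvd (lead_monom g) (lead_monom f)"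
    using lead_monom_gen[OF ij(1,2)] ij(4) by (intro bexI[of _ "gen i j"]) auto
qed

lemma zero_set_ideal_gens:
  "d \<ge> 2 \<Longrightarrow> zero_set d (ideal_gen d (gens d)) = zariski_closure d (real_image (odeco_map d UNIV))"
  by (simp add: zariski_closure_eq[OF real_image_odeco_map_subset_aspace]
      ideal_gens_eq_vanishing_ideal_odeco_map)

lemma irr_chain_odeco:
  assumes "d \<ge> 2"
  shows "irr_chain d (zariski_closure d (real_image (odeco_map d UNIV))) 3"
proof -
  define A where "A k = set (take k [d + 1, 2, 1])" for k
  have odeco_map_A3: "odeco_map d (A 3) = odeco_map d UNIV"
    by (simp add: odeco_map_def A_def fun_eq_iff eval_nat_numeral)
  have "irr_chain d (zariski_closure d (real_image (odeco_map d (A 3)))) 3"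
  proof (rule irr_chain_real_images)
    show "real_image (odeco_map d (A k)) \<subseteq> aspace d" for k
      by (rule real_image_odeco_map_subset_aspace)
    show "real_image (odeco_map d (A k)) \<subseteq> real_image (odeco_map d (A (Suc k)))" for k
      unfolding A_def by (intro real_image_odeco_map_mono set_take_subset_set_take) simp
    have "odeco_map d (A 3) 1 \<noteq> 0" using lead_monom_odeco_map(1) assms by (simp add: odeco_map_A3)
    fix k :: nat assume "k < 3"
    then consider (none) "k = 0" | (a) "k = 1" | (ab) "k = 2" by linarith
    then show "\<not> vanishing_ideal d (real_image (odeco_map d (A k))) \<subseteq>
        vanishing_ideal d (real_image (odeco_map d (A (Suc k))))"
    proof cases
      case none
      show ?thesis
        by (rule vanishing_ideal_real_image_not_subset[of 0])
          (use assms in \<open>simp_all add: none A_def odeco_map_def odeco_coords_def\<close>)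
    next
      case a
      show ?thesis
        by (rule vanishing_ideal_real_image_not_subset[of d])
          (use assms in \<open>simp_all add: a A_def odeco_map_def odeco_coords_def power_0_left\<close>)
    next
      case ab
      show ?thesis
        by (rule vanishing_ideal_real_image_not_subset[of 1])
          (use assms \<open>odeco_map d (A 3) 1 \<noteq> 0\<close> in
            \<open>simp_all add: ab A_def odeco_map_def odeco_coords_def power_0_left\<close>)
    qed
  qed
  then show ?thesis by (simp only: odeco_map_A3)
qed

lemma has_dim_zero_set_ideal_gens:
  assumes "d \<ge> 2"
  shows "has_dim d (zero_set d (ideal_gen d (gens d))) 3"
proof -
  have "\<not> irr_chain d (zariski_closure d (real_image (odeco_map d UNIV))) (Suc 3)"
  proof
    assume "irr_chain d (zariski_closure d (real_image (odeco_map d UNIV))) (Suc 3)"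
    then have "Suc 3 \<le> card {1, 2, d + 1}"
      by (rule irr_chain_zariski_closure_real_image_le[rotated 3])
        (use odeco_map_polys_in real_image_odeco_map_subset_aspace in auto)
    also have "\<dots> \<le> 3" by (simp add: card_insert_if)
    finally show False by simp
  qed
  with irr_chain_odeco[OF assms] show ?thesis
    by (simp add: has_dim_def zero_set_ideal_gens[OF assms])
qed

theorem theorem3p6:
  fixes d :: nat
  assumes "d \<ge> 2"
  shows "groebner_basis (gens d) (ideal_gen d (gens d))
         \<and> has_dim d (zero_set d (ideal_gen d (gens d))) 3 \<and> 3 = (2 + 1 choose 2)
         \<and> prime_ideal d (ideal_gen d (gens d))
         \<and> ideal_gen d (gens d) = vanishing_ideal d (odeco_variety d)"
proof (intro conjI)
  show "groebner_basis (gens d) (ideal_gen d (gens d))"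
    using assms by (rule groebner_basis_gens)
  show "has_dim d (zero_set d (ideal_gen d (gens d))) 3"
    using assms by (rule has_dim_zero_set_ideal_gens)
  show "3 = (2 + 1 choose 2)" by (simp add: choose_two)
  show "prime_ideal d (ideal_gen d (gens d))"
    using assms by (rule prime_ideal_gens)
  show "ideal_gen d (gens d) = vanishing_ideal d (odeco_variety d)"
    using assms by (rule ideal_gens_eq_vanishing_ideal_odeco_variety)
qed

end
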